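(* Let $J\in\mathbb{R}^{n\times n}$ be a symmetric matrix and let $\mathcal{K}$ be a symmetric stochastic $n\times n$ matrix. Let $\mathcal{A}$ denote the partition of $[n]$ induced by the irreducible components of $\mathcal{K}$. (1) A probability measure $p\in\mathcal{P}_{\mathcal{A}}(\Omega)$ is a stationary state (i.e. $p\circ p=p$, equivalently the solution $p_t$ of the nonlinear equation started from $p$ satisfies $p_t=p$ for all $t\ge 0$) if and only if $p=\mu_{J,h}$ for some $h\in\Gamma_{\mathcal{A}}$. (2) Along the solution $p_t$ of the nonlinear equation, the quantities $m(p_t,A)$, $A\in\mathcal{A}$, are independent of $t\ge 0$. (3) For any initial state $p\in\mathcal{P}_{\mathcal{A}}(\Omega)$, the solution $p_t$ of the nonlinear equation satisfies $$\|p_t-\mu_{J,h}\|_{\rm TV}\longrightarrow 0,\qquad t\to\infty,$$ where $\|\cdot\|_{\rm TV}$ is the total variation distance and $h$ is the unique vector $h\in\Gamma_{\mathcal{A}}$ such that $m_{\mathcal{A}}(p)=m_{\mathcal{A}}(\mu_{J,h})$.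
   Context: Let $n\ge 1$ be an integer, $[n]=\{1,\dots,n\}$, $\Omega=\{-1,+1\}^n$, and let $\mathcal{P}(\Omega)$ be the set of probability measures on $\Omega$. For symmetric $J\in\mathbb{R}^{n\times n}$ and $h\in\mathbb{R}^n$, the Ising measure is $$\mu_{J,h}(\sigma)=\frac1{Z_{J,h}}\exp\Big(\tfrac12\sum_{i,j\in[n]}J_{i,j}\sigma_i\sigma_j+\sum_{i\in[n]}h_i\sigma_i\Big),\quad \sigma\in\Omega,$$ with $Z_{J,h}$ the normalizing constant; $\mu_J:=\mu_{J,0}$. For $\ell\in[n]$, $\sigma\in\Omega$, $a\in\{-1,1\}$, $S_\ell(\sigma,a)\in\Omega$ is the configuration equal to $a$ at site $\ell$ and to $\sigma_i$ at every site $i\neq\ell$. Define $$p_J(\ell,k\,|\,\sigma,\sigma')=\frac{\mu_J(S_\ell(\sigma,\sigma'_k))\,\mu_J(S_k(\sigma',\sigma_\ell))}{\mu_J(\sigma)\mu_J(\sigma')+\mu_J(S_\ell(\sigma,\sigma'_k))\,\mu_J(S_k(\sigma',\sigma_\ell))},$$ $$Q_J^{\ell,k}(\sigma,\sigma';\tau,\tau')=p_J(\ell,k|\sigma,\sigma')\mathbf{1}(\tau=S_\ell(\sigma,\sigma'_k),\tau'=S_k(\sigma',\sigma_\ell))+(1-p_J(\ell,k|\sigma,\sigma'))\mathbf{1}(\tau=\sigma,\tau'=\sigma'),$$ $$\mathcal{Q}_J^{\mathcal{K}}(\sigma,\sigma';\tau,\tau')=\frac1n\sum_{\ell,k=1}^n\mathcal{K}(\ell,k)\,Q_J^{\ell,k}(\sigma,\sigma';\tau,\tau').$$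 The collision product of $p,q\in\mathcal{P}(\Omega)$ is $$p\circ q(\tau)=\frac12\sum_{\sigma,\sigma',\tau'\in\Omega}\big(p(\sigma)q(\sigma')+p(\sigma')q(\sigma)\big)\mathcal{Q}_J^{\mathcal{K}}(\sigma,\sigma';\tau,\tau').$$ The nonlinear equation with initial datum $p\in\mathcal{P}(\Omega)$ is $\frac{dp_t}{dt}=p_t\circ p_t-p_t$, $p_0=p$; it has a unique solution $p_t\in\mathcal{P}(\Omega)$, $t\ge0$. The irreducible components of $\mathcal{K}$ are the equivalence classes of the relation on $[n]$: $i\sim j$ iff $\mathcal{K}^m(i,j)>0$ for some integer $m\ge0$. For a partition $\mathcal{A}$ of $[n]$: $\Gamma_{\mathcal{A}}=\{h\in\mathbb{R}^n: h_i=h_j\ \forall i,j\in A,\ \forall A\in\mathcal{A}\}$; $m(p,A)=\frac1{|A|}\sum_{\ell\in A}p[\sigma_\ell]$, where $p[\sigma_\ell]$ is the expectation of $\sigma_\ell$ under $p$; $m_{\mathcal{A}}(p)=(m(p,A),A\in\mathcal{A})\in[-1,1]^{\mathcal{A}}$; and $\mathcal{P}_{\mathcal{A}}(\Omega)$ is the set of $p\in\mathcal{P}(\Omega)$ with $|m(p,A)|\neq1$ for all $A\in\mathcal{A}$. For every $p\in\mathcal{P}_{\mathcal{A}}(\Omega)$ there is a unique $h\in\Gamma_{\mathcal{A}}$ with $m_{\mathcal{A}}(p)=m_{\mathcal{A}}(\mu_{J,h})$. *)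

theory Defs
  imports "HOL-Analysis.Analysis" "HOL-Probability.Probability"
begin

text \<open>The set of sites is a finite type \<open>'n\<close>, so \<open>CARD('n)\<close> plays the role of \<open>n\<close>.\<close>

section \<open>Ising measures\<close>

definition Omega :: "(real ^ 'n::finite) set" where
  "Omega = {\<sigma>. \<forall>i. \<sigma> $ i \<in> {-1, 1}}"

definition Prob :: "(real ^ 'n::finite) pmf set" where
  "Prob = {p. set_pmf p \<subseteq> Omega}"

definition ising_weight :: "real ^ 'n ^ 'n \<Rightarrow> real ^ 'n \<Rightarrow> real ^ 'n::finite \<Rightarrow> real" where
  "ising_weight J h \<sigma> =
     exp (1/2 * (\<Sum>i\<in>UNIV. \<Sum>j\<in>UNIV. J $ i $ j * \<sigma> $ i * \<sigma> $ j) + (\<Sum>i\<in>UNIV. h $ i * \<sigma> $ i))"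

definition ising_Z :: "real ^ 'n ^ 'n \<Rightarrow> real ^ 'n::finite \<Rightarrow> real" where
  "ising_Z J h = (\<Sum>\<sigma>\<in>Omega. ising_weight J h \<sigma>)"

definition ising :: "real ^ 'n ^ 'n \<Rightarrow> real ^ 'n \<Rightarrow> (real ^ 'n::finite) pmf" where
  "ising J h = embed_pmf (\<lambda>\<sigma>. if \<sigma> \<in> Omega then ising_weight J h \<sigma> / ising_Z J h else 0)"

lemma finite_Omega: "finite (Omega :: (real ^ 'n::finite) set)"
proof -
  have "Omega \<subseteq> (\<lambda>f. \<chi> i. f i) ` (PiE (UNIV :: 'n set) (\<lambda>_. {-1, 1 :: real}))"
  proof
    fix \<sigma> :: "real ^ 'n" assume "\<sigma> \<in> Omega"
    then have "(\<lambda>i. \<sigma> $ i) \<in> PiE UNIV (\<lambda>_. {-1, 1})"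
      by (simp add: Omega_def PiE_UNIV_domain)
    moreover have "\<sigma> = (\<chi> i. \<sigma> $ i)" by simp
    ultimately show "\<sigma> \<in> (\<lambda>f. \<chi> i. f i) ` (PiE (UNIV :: 'n set) (\<lambda>_. {-1, 1 :: real}))"
      by blast
  qed
  moreover have "finite (PiE (UNIV :: 'n set) (\<lambda>_. {-1, 1 :: real}))"
    by (rule finite_PiE) auto
  ultimately show ?thesis using finite_surj by blast
qed

lemma Omega_nonempty: "(Omega :: (real ^ 'n::finite) set) \<noteq> {}"
proof -
  have "(\<chi> i. 1) \<in> (Omega :: (real ^ 'n) set)" by (simp add: Omega_def)
  then show ?thesis by blast
qed

lemma ising_Z_pos: "ising_Z J h > 0"
  unfolding ising_Z_def
  by (rule sum_pos) (simp_all add: finite_Omega Omega_nonempty ising_weight_def)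

lemma
  shows pmf_ising: "pmf (ising J h) \<sigma> = (if \<sigma> \<in> Omega then ising_weight J h \<sigma> / ising_Z J h else 0)"
    and set_pmf_ising: "set_pmf (ising J h) = Omega"
proof -
  let ?f = "\<lambda>\<sigma>. if \<sigma> \<in> Omega then ising_weight J h \<sigma> / ising_Z J h else 0"
  have pos: "0 \<le> ?f \<sigma>" for \<sigma>
    using ising_Z_pos[of J h] by (simp add: ising_weight_def)
  have "(\<integral>\<^sup>+\<sigma>. ennreal (?f \<sigma>) \<partial>count_space UNIV) = (\<Sum>\<sigma>\<in>Omega. ennreal (?f \<sigma>))"
    by (rule nn_integral_count_space'[OF finite_Omega]) auto
  also have "\<dots> = ennreal (\<Sum>\<sigma>\<in>Omega. ?f \<sigma>)"
    by (rule sum_ennreal) (rule pos)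
  also have "(\<Sum>\<sigma>\<in>Omega. ?f \<sigma>) = 1"
    using ising_Z_pos[of J h] by (simp add: sum_divide_distrib[symmetric] ising_Z_def)
  finally have total: "(\<integral>\<^sup>+\<sigma>. ennreal (?f \<sigma>) \<partial>count_space UNIV) = 1" by simp
  show "pmf (ising J h) \<sigma> = ?f \<sigma>"
    unfolding ising_def by (rule pmf_embed_pmf[OF pos total])
  have "?f \<sigma> \<noteq> 0 \<longleftrightarrow> \<sigma> \<in> Omega" for \<sigma>
    using ising_Z_pos[of J h] by (simp add: ising_weight_def)
  then show "set_pmf (ising J h) = Omega"
    unfolding ising_def by (subst set_embed_pmf[OF pos total]) auto
qed

section \<open>Collision product and nonlinear equation\<close>

definition set_spin :: "'n \<Rightarrow> real ^ 'n \<Rightarrow> real \<Rightarrow> real ^ 'n::finite" where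
  "set_spin l \<sigma> a = (\<chi> i. if i = l then a else \<sigma> $ i)"

definition swap_prob :: "real ^ 'n ^ 'n \<Rightarrow> 'n \<Rightarrow> 'n \<Rightarrow> real ^ 'n \<Rightarrow> real ^ 'n::finite \<Rightarrow> real" where
  "swap_prob J l k \<sigma> \<sigma>' =
    (let \<mu> = pmf (ising J 0); \<tau> = set_spin l \<sigma> (\<sigma>' $ k); \<tau>' = set_spin k \<sigma>' (\<sigma> $ l)
     in \<mu> \<tau> * \<mu> \<tau>' / (\<mu> \<sigma> * \<mu> \<sigma>' + \<mu> \<tau> * \<mu> \<tau>'))"

definition site_kernel ::
  "real ^ 'n ^ 'n \<Rightarrow> 'n \<Rightarrow> 'n \<Rightarrow> real ^ 'n \<Rightarrow> real ^ 'n \<Rightarrow> real ^ 'n \<Rightarrow> real ^ 'n::finite \<Rightarrow> real" where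
  "site_kernel J l k \<sigma> \<sigma>' \<tau> \<tau>' =
     swap_prob J l k \<sigma> \<sigma>' * of_bool (\<tau> = set_spin l \<sigma> (\<sigma>' $ k) \<and> \<tau>' = set_spin k \<sigma>' (\<sigma> $ l))
     + (1 - swap_prob J l k \<sigma> \<sigma>') * of_bool (\<tau> = \<sigma> \<and> \<tau>' = \<sigma>')"

definition kernel ::
  "real ^ 'n ^ 'n \<Rightarrow> real ^ 'n ^ 'n \<Rightarrow> real ^ 'n \<Rightarrow> real ^ 'n \<Rightarrow> real ^ 'n \<Rightarrow> real ^ 'n::finite \<Rightarrow> real" where
  "kernel J K \<sigma> \<sigma>' \<tau> \<tau>' =
     1 / real CARD('n) * (\<Sum>l\<in>UNIV. \<Sum>k\<in>UNIV. K $ l $ k * site_kernel J l k \<sigma> \<sigma>' \<tau> \<tau>')"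

text \<open>The collision product is given by its mass function on \<^const>\<open>Omega\<close>.\<close>

definition collision ::
  "real ^ 'n ^ 'n \<Rightarrow> real ^ 'n ^ 'n \<Rightarrow> (real ^ 'n) pmf \<Rightarrow> (real ^ 'n) pmf \<Rightarrow> real ^ 'n::finite \<Rightarrow> real" where
  "collision J K p q \<tau> =
     1/2 * (\<Sum>\<sigma>\<in>Omega. \<Sum>\<sigma>'\<in>Omega. \<Sum>\<tau>'\<in>Omega.
       (pmf p \<sigma> * pmf q \<sigma>' + pmf p \<sigma>' * pmf q \<sigma>) * kernel J K \<sigma> \<sigma>' \<tau> \<tau>')"

definition stationary :: "real ^ 'n ^ 'n \<Rightarrow> real ^ 'n ^ 'n \<Rightarrow> (real ^ 'n::finite) pmf \<Rightarrow> bool" where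
  "stationary J K p \<longleftrightarrow> (\<forall>\<tau>\<in>Omega. collision J K p p \<tau> = pmf p \<tau>)"

text \<open>Only the values of \<open>P\<close> on \<open>{0..}\<close> matter; the derivative at \<open>0\<close> is one-sided.\<close>

definition solves_nonlinear ::
  "real ^ 'n ^ 'n \<Rightarrow> real ^ 'n ^ 'n \<Rightarrow> (real ^ 'n) pmf \<Rightarrow> (real \<Rightarrow> (real ^ 'n::finite) pmf) \<Rightarrow> bool" where
  "solves_nonlinear J K p P \<longleftrightarrow>
     P 0 = p \<and> (\<forall>t\<ge>0. P t \<in> Prob) \<and>
     (\<forall>t\<ge>0. \<forall>\<tau>\<in>Omega. ((\<lambda>s. pmf (P s) \<tau>) has_real_derivative
        collision J K (P t) (P t) \<tau> - pmf (P t) \<tau>) (at t within {0..}))"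

section \<open>Irreducible components and magnetizations\<close>

definition stochastic_matrix :: "real ^ 'n ^ 'n::finite \<Rightarrow> bool" where
  "stochastic_matrix K \<longleftrightarrow> (\<forall>i j. 0 \<le> K $ i $ j) \<and> (\<forall>i. (\<Sum>j\<in>UNIV. K $ i $ j) = 1)"

text \<open>The matrix power \<open>K\<^sup>m\<close> is an iterate of \<^const>\<open>matrix_matrix_mult\<close>, since \<open>K ^ m\<close>
  would be the entrywise power.\<close>

definition irreducible_components :: "real ^ 'n ^ 'n::finite \<Rightarrow> 'n set set" where
  "irreducible_components K = UNIV // {(i, j). \<exists>m::nat. ((matrix_matrix_mult K ^^ m) (mat 1)) $ i $ j > 0}"

definition Gamma_part :: "'n set set \<Rightarrow> (real ^ 'n::finite) set" where
  "Gamma_part \<A> = {h. \<forall>A\<in>\<A>. \<forall>i\<in>A. \<forall>j\<in>A. h $ i = h $ j}"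

definition mag :: "(real ^ 'n::finite) pmf \<Rightarrow> 'n set \<Rightarrow> real" where
  "mag p A = 1 / real (card A) * (\<Sum>l\<in>A. measure_pmf.expectation p (\<lambda>\<sigma>. \<sigma> $ l))"

definition mags :: "'n set set \<Rightarrow> (real ^ 'n::finite) pmf \<Rightarrow> 'n set \<Rightarrow> real" where
  "mags \<A> p = (\<lambda>A\<in>\<A>. mag p A)"

definition Prob_part :: "'n set set \<Rightarrow> (real ^ 'n::finite) pmf set" where
  "Prob_part \<A> = {p \<in> Prob. \<forall>A\<in>\<A>. \<bar>mag p A\<bar> \<noteq> 1}"

definition tv_dist :: "'a pmf \<Rightarrow> 'a pmf \<Rightarrow> real" where
  "tv_dist p q = (SUP E. \<bar>measure_pmf.prob p E - measure_pmf.prob q E\<bar>)"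

end

theory Submission
  imports Defs
begin

text \<open>
  Write \<open>Q u = u \<circ> u\<close>. A collision of the particles \<open>(\<sigma>, \<sigma>')\<close> at the sites \<open>(l, k)\<close> either leaves the
  pair alone or exchanges the spins \<open>\<sigma>\<^sub>l\<close> and \<open>\<sigma>'\<^sub>k\<close>, and the exchange \<open>x \<mapsto> x*\<close> is an involution of
  the set of pairs. Since the acceptance probability is reversible for \<open>\<mu>\<^sub>J \<otimes> \<mu>\<^sub>J\<close>, testing
  \<open>Q u - u\<close> against \<open>\<phi>\<close> gives, after symmetrisation (\<open>symmetrised_weak_form\<close>), a negative multiple of
  the \<open>K\<close>-weighted sum over all edges \<open>K l k > 0\<close> and all pairs \<open>x\<close> of
  \<open>(flux x - flux x*) (\<Phi> x - \<Phi> x*)\<close> with \<open>\<Phi> (\<sigma>, \<sigma>') = \<phi> \<sigma> + \<phi> \<sigma>'\<close>.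
  Conservation laws, entropy decay and the analysis of supports all come from this identity.

  Conservation. If \<open>\<phi> \<sigma> = \<Sum>\<^sub>i g\<^sub>i \<sigma>\<^sub>i\<close> with \<open>g\<close> constant along the edges of \<open>K\<close>, then
  \<open>\<Phi> x = \<Phi> x*\<close>; so the mean spin of every irreducible component is preserved.

  Entropy. For \<open>h\<close> constant on the components, \<open>\<mu>\<^bsub>J,h\<^esub>\<close> satisfies the same detailed balance as
  \<open>\<mu>\<^sub>J\<close>. Taking \<open>\<phi> = ln (u / \<mu>\<^bsub>J,h\<^esub>)\<close> turns \<open>\<Phi> x - \<Phi> x*\<close> into \<open>ln (flux x) - ln (flux x*)\<close>, hence
  the relative entropy decays at least at the rate of a multiple of \<open>\<Sum> (flux x - flux x*)\<^sup>2\<close>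
  (\<open>entropy_production\<close>). This dissipation is a polynomial in \<open>u\<close>, therefore continuous up to the
  boundary of the simplex. It vanishes only if opposite fluxes agree along every edge; if \<open>u\<close> also charges every
  configuration, the single spin increments of \<open>ln (u / \<mu>\<^sub>J)\<close> are forced to be constant on
  components, and \<open>u = \<mu>\<^bsub>J,h\<^esub>\<close> (\<open>balanced_positive_is_ising\<close>).

  Full support. The support of a stationary \<open>u\<close>, and the eventual support of a solution, are closed
  under exchanges along edges. When no component has mean spin \<open>\<plusminus>1\<close>, both spin values occur at some
  site of each component, then at every site, so single spins can be changed at will and the support
  is everything (\<open>full_support\<close>). This settles the stationary states.

  Convergence. The entropy is bounded below, so the dissipation is small along some sequence of
  times. At a limit point along that sequence opposite fluxes agree; it has the conserved mean spins, hence full support, so it is some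
  \<open>\<mu>\<^bsub>J,h\<^esub>\<close>; strict monotonicity of \<open>ln\<close> shows that the mean spins determine \<open>h\<close>. Thus the limit point
  also provides the field \<open>h\<close> attached to given mean spins. The entropy relative to this
  \<open>\<mu>\<^bsub>J,h\<^esub>\<close> is nonincreasing and tends to \<open>0\<close> along the sequence, hence for all times, and it dominates
  the squared Hellinger distance. Applied to a solution that starts in \<open>\<mu>\<^bsub>J,h\<^esub>\<close>, the same
  monotonicity shows that the solution never moves.

  Existence of solutions, needed to deduce stationarity from the constancy of all solutions and to
  produce \<open>h\<close>, comes from Wild's series (\<open>solution_ex\<close>).
\<close>

section \<open>Exchanging spins between two configurations\<close>

definition exchange :: "'n \<Rightarrow> 'n \<Rightarrow> (real ^ 'n) \<times> (real ^ 'n) \<Rightarrow> (real ^ 'n::finite) \<times> (real ^ 'n)" where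
  "exchange l k x = (set_spin l (fst x) (snd x $ k), set_spin k (snd x) (fst x $ l))"

lemma set_spin_nth [simp]: "set_spin l \<sigma> a $ i = (if i = l then a else \<sigma> $ i)"
  by (simp add: set_spin_def)

lemma set_spin_in_Omega: "\<sigma> \<in> Omega \<Longrightarrow> a \<in> {-1, 1} \<Longrightarrow> set_spin l \<sigma> a \<in> Omega"
  by (auto simp: Omega_def)

lemma Omega_nth: "\<sigma> \<in> Omega \<Longrightarrow> \<sigma> $ i \<in> {-1, 1}"
  by (auto simp: Omega_def)

lemma exchange_involutive [simp]: "exchange l k (exchange l k x) = x"
  by (auto simp: exchange_def vec_eq_iff prod_eq_iff)

lemma exchange_in_Omega [simp]: "x \<in> Omega \<times> Omega \<Longrightarrow> exchange l k x \<in> Omega \<times> Omega"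
  unfolding exchange_def mem_Times_iff by (auto intro!: set_spin_in_Omega Omega_nth simp: insert_commute)

lemma exchange_flip: "exchange k l (prod.swap x) = prod.swap (exchange l k x)"
  by (simp add: exchange_def prod_eq_iff)

lemma linear_set_spin:
  "(\<Sum>i\<in>UNIV. g i * set_spin l \<sigma> a $ i) = (\<Sum>i\<in>UNIV. g i * \<sigma> $ i) + g l * (a - \<sigma> $ l)"
  for g :: "'n::finite \<Rightarrow> real"
proof -
  have "(\<Sum>i\<in>UNIV. g i * set_spin l \<sigma> a $ i) - (\<Sum>i\<in>UNIV. g i * \<sigma> $ i)
      = (\<Sum>i\<in>UNIV. if i = l then g l * (a - \<sigma> $ l) else 0)"
    unfolding sum_subtractf[symmetric] by (intro sum.cong) (auto simp: algebra_simps)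
  then show ?thesis by simp
qed

lemma linear_exchange:
  fixes g :: "'n::finite \<Rightarrow> real"
  assumes "g l = g k"
  shows "(\<Sum>i\<in>UNIV. g i * fst (exchange l k x) $ i) + (\<Sum>i\<in>UNIV. g i * snd (exchange l k x) $ i)
       = (\<Sum>i\<in>UNIV. g i * fst x $ i) + (\<Sum>i\<in>UNIV. g i * snd x $ i)"
  by (simp add: exchange_def linear_set_spin assms algebra_simps del: set_spin_nth)

text \<open>One overwrites \<open>\<sigma>\<^sub>0\<close> by the target configuration site by site. Applied to supports and to
  level sets of functions, this is how local information about spin changes becomes global.\<close>
lemma single_spin_changes_connect:
  fixes \<sigma>\<^sub>0 :: "real ^ 'n::finite"
  assumes "\<sigma>\<^sub>0 \<in> S"
    and "\<And>\<sigma> l a. \<sigma> \<in> S \<Longrightarrow> a \<in> {-1, 1} \<Longrightarrow> set_spin l \<sigma> a \<in> S"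
  shows "Omega \<subseteq> S"
proof
  fix \<tau> :: "real ^ 'n" assume \<tau>: "\<tau> \<in> Omega"
  have "(\<chi> i. if i \<in> B then \<tau> $ i else \<sigma>\<^sub>0 $ i) \<in> S" for B
  proof (induction B rule: finite_induct[OF finite])
    case 1 show ?case using assms(1) by simp
  next
    case (2 l B)
    have "(\<chi> i. if i \<in> insert l B then \<tau> $ i else \<sigma>\<^sub>0 $ i)
        = set_spin l (\<chi> i. if i \<in> B then \<tau> $ i else \<sigma>\<^sub>0 $ i) (\<tau> $ l)"
      by (simp add: vec_eq_iff)
    then show ?case using assms(2)[OF 2(3) Omega_nth[OF \<tau>]] by simp
  qed
  from this[of UNIV] show "\<tau> \<in> S" by simp
qed

definition pair_mass :: "(real ^ 'n \<Rightarrow> real) \<Rightarrow> (real ^ 'n) \<times> (real ^ 'n) \<Rightarrow> real" where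
  "pair_mass u x = u (fst x) * u (snd x)"

text \<open>For a pair distributed like \<open>u \<otimes> u\<close> that collides at \<open>(l, k)\<close>, the probability to be in \<open>x\<close> and to
  exchange spins. The flux at \<open>exchange l k x\<close> measures the opposite transition, into \<open>x\<close>.\<close>
definition flux ::
  "real ^ 'n ^ 'n \<Rightarrow> (real ^ 'n \<Rightarrow> real) \<Rightarrow> 'n \<Rightarrow> 'n \<Rightarrow> (real ^ 'n) \<times> (real ^ 'n::finite) \<Rightarrow> real" where
  "flux J u l k x = swap_prob J l k (fst x) (snd x) * pair_mass u x"

text \<open>The collision product for arbitrary functions: the entropy argument passes to limits of mass
  functions, and Wild's series uses unnormalised ones.\<close>
definition collide ::
  "real ^ 'n ^ 'n \<Rightarrow> real ^ 'n ^ 'n \<Rightarrow> (real ^ 'n \<Rightarrow> real) \<Rightarrow> (real ^ 'n \<Rightarrow> real) \<Rightarrow> real ^ 'n::finite \<Rightarrow> real" where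
  "collide J K u v \<tau> = 1/2 * (\<Sum>\<sigma>\<in>Omega. \<Sum>\<sigma>'\<in>Omega. \<Sum>\<tau>'\<in>Omega.
       (u \<sigma> * v \<sigma>' + u \<sigma>' * v \<sigma>) * kernel J K \<sigma> \<sigma>' \<tau> \<tau>')"

lemma collision_eq_collide: "collision J K p q \<tau> = collide J K (pmf p) (pmf q) \<tau>"
  by (simp add: collision_def collide_def)

lemma swap_prob_eq:
  "swap_prob J l k (fst x) (snd x) = pair_mass (pmf (ising J 0)) (exchange l k x) /
     (pair_mass (pmf (ising J 0)) x + pair_mass (pmf (ising J 0)) (exchange l k x))"
  by (simp add: swap_prob_def Let_def pair_mass_def exchange_def)

lemma pmf_ising_pos: "\<sigma> \<in> Omega \<Longrightarrow> 0 < pmf (ising J h) \<sigma>"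
  using ising_Z_pos[of J h] by (simp add: pmf_ising ising_weight_def)

lemma pair_mass_ising_pos: "x \<in> Omega \<times> Omega \<Longrightarrow> 0 < pair_mass (pmf (ising J h)) x"
  by (auto simp: pair_mass_def pmf_ising_pos)

lemma swap_prob_pos: "x \<in> Omega \<times> Omega \<Longrightarrow> 0 < swap_prob J l k (fst x) (snd x)"
  unfolding swap_prob_eq
  using pair_mass_ising_pos[of x J 0] pair_mass_ising_pos[OF exchange_in_Omega[of x l k], of J 0]
  by (intro divide_pos_pos add_pos_pos)

lemma swap_prob_nonneg: "0 \<le> swap_prob J l k \<sigma> \<sigma>'"
  by (simp add: swap_prob_def Let_def)

lemma swap_prob_le_1: "swap_prob J l k \<sigma> \<sigma>' \<le> 1"
proof -
  have "b / (a + b) \<le> 1" if "0 \<le> a" "0 \<le> b" for a b :: real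
    using that by (cases "a + b = 0") (auto simp: divide_simps)
  then show ?thesis unfolding swap_prob_def Let_def by simp
qed

lemma site_kernel_nonneg: "0 \<le> site_kernel J l k \<sigma> \<sigma>' \<tau> \<tau>'"
  unfolding site_kernel_def using swap_prob_nonneg[of J l k \<sigma> \<sigma>'] swap_prob_le_1[of J l k \<sigma> \<sigma>']
  by (intro add_nonneg_nonneg mult_nonneg_nonneg) auto

lemma sum_of_bool_pair:
  fixes \<phi> :: "real ^ 'n::finite \<Rightarrow> real"
  assumes "a \<in> Omega" "b \<in> Omega"
  shows "(\<Sum>\<tau>\<in>Omega. \<Sum>\<tau>'\<in>Omega. c * of_bool (\<tau> = a \<and> \<tau>' = b) * \<phi> \<tau>) = c * \<phi> a"
proof -
  have "(\<Sum>\<tau>\<in>Omega. \<Sum>\<tau>'\<in>Omega. c * of_bool (\<tau> = a \<and> \<tau>' = b) * \<phi> \<tau>)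
      = (\<Sum>\<tau>\<in>Omega. \<Sum>\<tau>'\<in>Omega. if \<tau>' = b then (if \<tau> = a then c * \<phi> a else 0) else 0)"
    by (intro sum.cong) auto
  then show ?thesis using assms by (simp add: finite_Omega)
qed

lemma sum_site_kernel:
  assumes "x \<in> Omega \<times> Omega"
  shows "(\<Sum>\<tau>\<in>Omega. \<Sum>\<tau>'\<in>Omega. site_kernel J l k (fst x) (snd x) \<tau> \<tau>' * \<phi> \<tau>)
     = \<phi> (fst x) + swap_prob J l k (fst x) (snd x) * (\<phi> (fst (exchange l k x)) - \<phi> (fst x))"
proof -
  let ?c = "swap_prob J l k (fst x) (snd x)"
  have "(\<Sum>\<tau>\<in>Omega. \<Sum>\<tau>'\<in>Omega. site_kernel J l k (fst x) (snd x) \<tau> \<tau>' * \<phi> \<tau>)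
      = (\<Sum>\<tau>\<in>Omega. \<Sum>\<tau>'\<in>Omega. ?c * of_bool (\<tau> = fst (exchange l k x) \<and> \<tau>' = snd (exchange l k x)) * \<phi> \<tau>)
      + (\<Sum>\<tau>\<in>Omega. \<Sum>\<tau>'\<in>Omega. (1 - ?c) * of_bool (\<tau> = fst x \<and> \<tau>' = snd x) * \<phi> \<tau>)"
    unfolding sum.distrib[symmetric] site_kernel_def exchange_def fst_conv snd_conv
    by (simp only: distrib_right)
  also have "\<dots> = ?c * \<phi> (fst (exchange l k x)) + (1 - ?c) * \<phi> (fst x)"
    using assms exchange_in_Omega[OF assms, of l k] by (intro arg_cong2[of _ _ _ _ "(+)"] sum_of_bool_pair) (auto simp: mem_Times_iff)
  finally show ?thesis by (simp add: algebra_simps)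
qed

lemma sum_swap_outermost:
  "(\<Sum>a\<in>A. \<Sum>l\<in>L. \<Sum>k\<in>M. g a l k) = (\<Sum>l\<in>L. \<Sum>k\<in>M. \<Sum>a\<in>A. g a l k)"
  by (rule trans[OF sum.swap]) (intro sum.cong refl sum.swap)

text \<open>Only the first outgoing particle is tested; it carries \<open>fst (exchange l k x)\<close> if the exchange is
  accepted and \<open>fst x\<close> otherwise.\<close>
lemma collide_weak:
  fixes J K :: "real ^ 'n ^ 'n::finite"
  shows "(\<Sum>\<tau>\<in>Omega. collide J K u v \<tau> * \<phi> \<tau>) =
    1 / (2 * real CARD('n)) * (\<Sum>l\<in>UNIV. \<Sum>k\<in>UNIV. K $ l $ k * (\<Sum>x\<in>Omega \<times> Omega.
       (u (fst x) * v (snd x) + u (snd x) * v (fst x)) *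
       (\<phi> (fst x) + swap_prob J l k (fst x) (snd x) * (\<phi> (fst (exchange l k x)) - \<phi> (fst x)))))"
proof -
  let ?U = "\<lambda>x. u (fst x) * v (snd x) + u (snd x) * v (fst x)"
  let ?sk = "\<lambda>l k x \<tau> \<tau>'. site_kernel J l k (fst x) (snd x) \<tau> \<tau>'"
  have "(\<Sum>\<tau>\<in>Omega. collide J K u v \<tau> * \<phi> \<tau>)
      = (\<Sum>\<tau>\<in>Omega. \<Sum>x\<in>Omega \<times> Omega. \<Sum>\<tau>'\<in>Omega. \<Sum>l\<in>UNIV. \<Sum>k\<in>UNIV.
           1 / (2 * real CARD('n)) * (K $ l $ k * (?U x * (?sk l k x \<tau> \<tau>' * \<phi> \<tau>))))"
  proof -
    have "collide J K u v \<tau> = 1/2 * (\<Sum>x\<in>Omega \<times> Omega. \<Sum>\<tau>'\<in>Omega.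
        ?U x * kernel J K (fst x) (snd x) \<tau> \<tau>')" for \<tau>
      unfolding collide_def by (subst sum.cartesian_product) (simp add: case_prod_beta)
    then show ?thesis
      unfolding kernel_def by (simp only: sum_distrib_left sum_distrib_right) (simp add: mult_ac)
  qed
  also have "\<dots> = (\<Sum>l\<in>UNIV. \<Sum>k\<in>UNIV. \<Sum>x\<in>Omega \<times> Omega. \<Sum>\<tau>\<in>Omega. \<Sum>\<tau>'\<in>Omega.
           1 / (2 * real CARD('n)) * (K $ l $ k * (?U x * (?sk l k x \<tau> \<tau>' * \<phi> \<tau>))))"
  proof -
    have "(\<Sum>\<tau>'\<in>Omega. \<Sum>l\<in>UNIV. \<Sum>k\<in>UNIV. g \<tau>' l k) = (\<Sum>l\<in>UNIV. \<Sum>k\<in>UNIV. \<Sum>\<tau>'\<in>Omega. g \<tau>' l k)"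
      for g :: "real ^ 'n \<Rightarrow> 'n \<Rightarrow> 'n \<Rightarrow> real"
      by (rule sum_swap_outermost)
    moreover have "(\<Sum>x\<in>Omega \<times> Omega. \<Sum>l\<in>UNIV. \<Sum>k\<in>UNIV. g x l k)
        = (\<Sum>l\<in>UNIV. \<Sum>k\<in>UNIV. \<Sum>x\<in>Omega \<times> Omega. g x l k)"
      for g :: "(real ^ 'n) \<times> (real ^ 'n) \<Rightarrow> 'n \<Rightarrow> 'n \<Rightarrow> real"
      by (rule sum_swap_outermost)
    moreover have "(\<Sum>\<tau>\<in>Omega. \<Sum>x\<in>Omega \<times> Omega. h \<tau> x) = (\<Sum>x\<in>Omega \<times> Omega. \<Sum>\<tau>\<in>Omega. h \<tau> x)"
      for h :: "real ^ 'n \<Rightarrow> (real ^ 'n) \<times> (real ^ 'n) \<Rightarrow> real"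
      by (rule sum.swap)
    ultimately show ?thesis by simp
  qed
  also have "\<dots> = 1 / (2 * real CARD('n)) * (\<Sum>l\<in>UNIV. \<Sum>k\<in>UNIV. K $ l $ k * (\<Sum>x\<in>Omega \<times> Omega.
       ?U x * (\<Sum>\<tau>\<in>Omega. \<Sum>\<tau>'\<in>Omega. ?sk l k x \<tau> \<tau>' * \<phi> \<tau>)))"
    by (simp only: sum_distrib_left)
  finally show ?thesis by (simp only: sum_site_kernel cong: sum.cong)
qed

section \<open>The symmetrised weak form of the collision operator\<close>

locale exchange_dynamics =
  fixes J K :: "real ^ 'n ^ 'n::finite"
  assumes K_sym: "K $ l $ k = K $ k $ l"
    and K_nonneg: "0 \<le> K $ l $ k"
    and K_row_sum: "(\<Sum>k\<in>UNIV. K $ l $ k) = 1"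
begin

abbreviation pair_sum :: "(real ^ 'n \<Rightarrow> real) \<Rightarrow> (real ^ 'n) \<times> (real ^ 'n) \<Rightarrow> real" where
  "pair_sum \<phi> x \<equiv> \<phi> (fst x) + \<phi> (snd x)"

lemma sum_exchange: "(\<Sum>x\<in>Omega \<times> Omega. f (exchange l k x)) = (\<Sum>x\<in>Omega \<times> Omega. f x)"
  for f :: "(real ^ 'n) \<times> (real ^ 'n) \<Rightarrow> real"
  by (rule sum.reindex_bij_witness[where i = "exchange l k" and j = "exchange l k"]) (simp_all del: mem_Times_iff)

lemma sum_flip: "(\<Sum>x\<in>Omega \<times> Omega. f (prod.swap x)) = (\<Sum>x\<in>Omega \<times> Omega. f x)"
  for f :: "(real ^ 'n) \<times> (real ^ 'n) \<Rightarrow> real"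
  by (rule sum.reindex_bij_witness[where i = "prod.swap" and j = "prod.swap"]) auto

lemma flux_flip: "flux J u k l (prod.swap x) = flux J u l k x"
  by (simp add: flux_def swap_prob_def pair_mass_def Let_def add.commute mult.commute)

text \<open>The gain and loss terms are averaged over the four descriptions of one collision: the two
  particles may trade roles (which trades the sites too, so that the symmetry of \<open>K\<close> enters), and
  the states before and after the exchange may trade roles, exchange being an involution.\<close>
lemma symmetrised_weak_form:
  assumes u: "(\<Sum>\<sigma>\<in>Omega. u \<sigma>) = 1"
  shows "(\<Sum>\<tau>\<in>Omega. (collide J K u u \<tau> - u \<tau>) * \<phi> \<tau>) =
    - (\<Sum>l\<in>UNIV. \<Sum>k\<in>UNIV. K $ l $ k * (\<Sum>x\<in>Omega \<times> Omega.
        (flux J u l k x - flux J u l k (exchange l k x)) *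
        (pair_sum \<phi> x - pair_sum \<phi> (exchange l k x)))) / (4 * real CARD('n))"
proof -
  define A where "A l k = (\<Sum>x\<in>Omega \<times> Omega.
      flux J u l k x * (\<phi> (fst (exchange l k x)) - \<phi> (fst x)))" for l k
  have n: "real CARD('n) > 0" by simp
  have "(\<Sum>x\<in>Omega \<times> Omega. (u (fst x) * u (snd x) + u (snd x) * u (fst x)) *
       (\<phi> (fst x) + swap_prob J l k (fst x) (snd x) * (\<phi> (fst (exchange l k x)) - \<phi> (fst x))))
     = 2 * ((\<Sum>\<tau>\<in>Omega. u \<tau> * \<phi> \<tau>) + A l k)" for l k
  proof -
    have "(\<Sum>x\<in>Omega \<times> Omega. u (fst x) * \<phi> (fst x) * u (snd x)) = (\<Sum>\<tau>\<in>Omega. u \<tau> * \<phi> \<tau>)"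
      by (simp add: sum.cartesian_product' flip: sum_distrib_left sum_distrib_right) (simp add: u)
    then have "2 * ((\<Sum>\<tau>\<in>Omega. u \<tau> * \<phi> \<tau>) + A l k) = (\<Sum>x\<in>Omega \<times> Omega.
        2 * (u (fst x) * \<phi> (fst x) * u (snd x) + flux J u l k x * (\<phi> (fst (exchange l k x)) - \<phi> (fst x))))"
      unfolding A_def sum_distrib_left[symmetric] sum.distrib by simp
    also have "\<dots> = (\<Sum>x\<in>Omega \<times> Omega. (u (fst x) * u (snd x) + u (snd x) * u (fst x)) *
       (\<phi> (fst x) + swap_prob J l k (fst x) (snd x) * (\<phi> (fst (exchange l k x)) - \<phi> (fst x))))"
      by (intro sum.cong refl) (simp add: flux_def pair_mass_def algebra_simps)
    finally show ?thesis by simp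
  qed
  then have "(\<Sum>\<tau>\<in>Omega. collide J K u u \<tau> * \<phi> \<tau>)
     = 1 / (2 * real CARD('n)) * (\<Sum>l\<in>UNIV. \<Sum>k\<in>UNIV. K $ l $ k * (2 * ((\<Sum>\<tau>\<in>Omega. u \<tau> * \<phi> \<tau>) + A l k)))"
    by (simp add: collide_weak)
  also have "\<dots> = (\<Sum>\<tau>\<in>Omega. u \<tau> * \<phi> \<tau>) + (\<Sum>l\<in>UNIV. \<Sum>k\<in>UNIV. K $ l $ k * A l k) / real CARD('n)"
  proof -
    have "(\<Sum>l\<in>UNIV. \<Sum>k\<in>UNIV. K $ l $ k * (2 * (c + A l k)))
       = 2 * (\<Sum>l\<in>UNIV. (\<Sum>k\<in>UNIV. K $ l $ k) * c) + 2 * (\<Sum>l\<in>UNIV. \<Sum>k\<in>UNIV. K $ l $ k * A l k)" for c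
      unfolding sum_distrib_left sum_distrib_right sum.distrib[symmetric]
      by (intro sum.cong refl) (simp add: algebra_simps)
    from this[of "\<Sum>\<tau>\<in>Omega. u \<tau> * \<phi> \<tau>"] show ?thesis using n by (simp only: K_row_sum) (simp add: add_divide_distrib distrib_left)
  qed
  finally have 1: "(\<Sum>\<tau>\<in>Omega. (collide J K u u \<tau> - u \<tau>) * \<phi> \<tau>)
      = (\<Sum>l\<in>UNIV. \<Sum>k\<in>UNIV. K $ l $ k * A l k) / real CARD('n)"
    by (simp add: left_diff_distrib sum_subtractf)
  \<comment> \<open>Exchanging the two colliding particles together with the two sites.\<close>
  have flip: "A k l = (\<Sum>x\<in>Omega \<times> Omega. flux J u l k x * (\<phi> (snd (exchange l k x)) - \<phi> (snd x)))" for l k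
    unfolding A_def by (subst sum_flip[symmetric]) (simp add: flux_flip exchange_flip)
  have "(\<Sum>l\<in>UNIV. \<Sum>k\<in>UNIV. K $ l $ k * A l k) = (\<Sum>l\<in>UNIV. \<Sum>k\<in>UNIV. K $ l $ k * A k l)"
    by (subst sum.swap) (simp add: K_sym)
  then have 2: "2 * (\<Sum>l\<in>UNIV. \<Sum>k\<in>UNIV. K $ l $ k * A l k)
      = (\<Sum>l\<in>UNIV. \<Sum>k\<in>UNIV. K $ l $ k * (A l k + A k l))"
    by (simp add: distrib_left sum.distrib)
  \<comment> \<open>Exchanging the configurations before and after the collision.\<close>
  have 3: "2 * (A l k + A k l) = - (\<Sum>x\<in>Omega \<times> Omega.
      (flux J u l k x - flux J u l k (exchange l k x)) * (pair_sum \<phi> x - pair_sum \<phi> (exchange l k x)))" for l k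
  proof -
    have "A l k + A k l = (\<Sum>x\<in>Omega \<times> Omega. flux J u l k x * (pair_sum \<phi> (exchange l k x) - pair_sum \<phi> x))"
      unfolding flip[of k l] unfolding A_def sum.distrib[symmetric] by (intro sum.cong) (auto simp: algebra_simps)
    moreover have "\<dots> = (\<Sum>x\<in>Omega \<times> Omega. flux J u l k (exchange l k x) * (pair_sum \<phi> x - pair_sum \<phi> (exchange l k x)))"
      by (subst sum_exchange[symmetric, of _ l k]) simp
    ultimately have "2 * (A l k + A k l) =
       (\<Sum>x\<in>Omega \<times> Omega. flux J u l k x * (pair_sum \<phi> (exchange l k x) - pair_sum \<phi> x)
         + flux J u l k (exchange l k x) * (pair_sum \<phi> x - pair_sum \<phi> (exchange l k x)))"
      by (simp add: sum.distrib)
    also have "\<dots> = (\<Sum>x\<in>Omega \<times> Omega. -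
      ((flux J u l k x - flux J u l k (exchange l k x)) * (pair_sum \<phi> x - pair_sum \<phi> (exchange l k x))))"
      by (intro sum.cong refl) (simp add: algebra_simps)
    finally show ?thesis by (simp only: sum_negf)
  qed
  have "4 * (\<Sum>l\<in>UNIV. \<Sum>k\<in>UNIV. K $ l $ k * A l k)
      = (\<Sum>l\<in>UNIV. \<Sum>k\<in>UNIV. K $ l $ k * (2 * (A l k + A k l)))"
  proof -
    have "(\<Sum>l\<in>UNIV. \<Sum>k\<in>UNIV. K $ l $ k * (2 * (A l k + A k l)))
        = 2 * (\<Sum>l\<in>UNIV. \<Sum>k\<in>UNIV. K $ l $ k * (A l k + A k l))"
      unfolding sum_distrib_left by (intro sum.cong refl) simp
    then show ?thesis using 2 by simp
  qed
  then show ?thesis unfolding 1 3 using n by (simp add: sum_negf field_simps)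
qed

end

section \<open>Irreducible components and detailed balance\<close>

text \<open>For a nonnegative matrix, a positive entry of \<open>K\<^sup>m\<close> means that there is a path of length \<open>m\<close> along positive
  entries of \<open>K\<close>. This replaces matrix powers by a reflexive transitive closure.\<close>
lemma irreducible_components_eq:
  fixes K :: "real ^ 'n ^ 'n::finite"
  assumes nonneg: "\<And>i j. 0 \<le> K $ i $ j"
  shows "irreducible_components K = UNIV // {(i, j). 0 < K $ i $ j}\<^sup>*"
proof -
  let ?E = "{(i, j). 0 < K $ i $ j}" and ?P = "\<lambda>m. ((**) K ^^ m) (mat 1)"
  have P_Suc: "?P (Suc m) $ i $ j = (\<Sum>k\<in>UNIV. K $ i $ k * ?P m $ k $ j)" for m i j
    by (simp add: matrix_matrix_mult_def)
  have "0 \<le> ?P m $ i $ j \<and> (0 < ?P m $ i $ j \<longleftrightarrow> (i, j) \<in> ?E ^^ m)" for m i j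
  proof (induction m arbitrary: i j)
    case 0 show ?case by (simp add: mat_def)
  next
    case (Suc m)
    have nn: "0 \<le> K $ i $ k * ?P m $ k $ j" for k
      using Suc nonneg by simp
    then have "0 < ?P (Suc m) $ i $ j \<longleftrightarrow> (\<exists>k. K $ i $ k * ?P m $ k $ j \<noteq> 0)"
      unfolding P_Suc by (subst order.strict_iff_order) (auto simp: sum_nonneg_eq_0_iff sum_nonneg)
    also have "\<dots> \<longleftrightarrow> (\<exists>k. (i, k) \<in> ?E \<and> (k, j) \<in> ?E ^^ m)"
      using Suc nonneg by (auto simp: order.strict_iff_order)
    also have "\<dots> \<longleftrightarrow> (i, j) \<in> ?E ^^ Suc m"
      by (simp only: relpow.simps relpow_commute[symmetric]) blast
    finally show ?case using nn by (simp only: P_Suc sum_nonneg)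
  qed
  then have "{(i, j). \<exists>m. ?P m $ i $ j > 0} = ?E\<^sup>*"
    by (auto simp: rtrancl_power)
  then show ?thesis by (simp add: irreducible_components_def)
qed

lemma pmf_ising_field:
  assumes "\<sigma> \<in> Omega"
  shows "pmf (ising J h) \<sigma> = ising_Z J 0 / ising_Z J h * (pmf (ising J 0) \<sigma> * exp (\<Sum>i\<in>UNIV. h $ i * \<sigma> $ i))"
  using assms ising_Z_pos[of J h] ising_Z_pos[of J 0]
  by (simp add: pmf_ising ising_weight_def exp_add)

text \<open>The factor by which \<open>\<mu>\<^bsub>J,h\<^esub> \<otimes> \<mu>\<^bsub>J,h\<^esub>\<close> differs from \<open>\<mu>\<^sub>J \<otimes> \<mu>\<^sub>J\<close> depends on the pair only
  through \<open>\<Sum>\<^sub>i h\<^sub>i (\<sigma>\<^sub>i + \<sigma>'\<^sub>i)\<close>, which an exchange between sites with equal field preserves. So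
  reversibility with respect to \<open>\<mu>\<^sub>J\<close> carries over.\<close>
lemma detailed_balance:
  assumes h: "h $ l = h $ k" and x: "x \<in> Omega \<times> Omega"
  shows "flux J (pmf (ising J h)) l k (exchange l k x) = flux J (pmf (ising J h)) l k x"
proof -
  define M where "M = pair_mass (pmf (ising J 0))"
  define e where "e x = exp ((\<Sum>i\<in>UNIV. h $ i * fst x $ i) + (\<Sum>i\<in>UNIV. h $ i * snd x $ i))" for x
  have "pair_mass (pmf (ising J h)) y = (ising_Z J 0 / ising_Z J h)\<^sup>2 * (M y * e y)"
    if "y \<in> Omega \<times> Omega" for y
    using that by (auto simp: pair_mass_def pmf_ising_field[of _ J h] M_def e_def exp_add power2_eq_square)
  moreover have "e (exchange l k x) = e x"
    unfolding e_def using linear_exchange[of "\<lambda>i. h $ i" l k x] h by simp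
  ultimately show ?thesis
    using x exchange_in_Omega[OF x, of l k] by (simp add: flux_def swap_prob_eq add.commute flip: M_def)
qed

text \<open>Trading the entropy production for a square keeps a quantity that is a polynomial in the mass
  function and so makes sense where the logarithm does not.\<close>
lemma diff_mult_ln_diff_ge:
  fixes a b :: real
  assumes "0 < a" "a \<le> 1" "0 < b" "b \<le> 1"
  shows "(a - b)\<^sup>2 \<le> (a - b) * (ln a - ln b)"
proof -
  have *: "(a - b)\<^sup>2 \<le> (a - b) * (ln a - ln b)" if "0 < b" "b \<le> a" "a \<le> 1" for a b :: real
  proof -
    have "ln (b / a) \<le> b / a - 1" using that by (intro ln_le_minus_one) auto
    then have "(a - b) / a \<le> ln a - ln b" using that by (simp add: ln_div diff_divide_distrib)
    moreover have "a - b \<le> (a - b) / a" using that by (simp add: pos_le_divide_eq mult_left_le)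
    ultimately show ?thesis using that by (simp add: power2_eq_square mult_left_mono)
  qed
  show ?thesis
  proof (cases "b \<le> a")
    case True then show ?thesis using * assms by blast
  next
    case False then show ?thesis using *[of a b] assms by (simp add: power2_commute algebra_simps)
  qed
qed

text \<open>Values outside \<^const>\<open>Omega\<close> are left free, so that pointwise limits and series qualify without
  adjustment.\<close>
definition mass_function :: "(real ^ 'n::finite \<Rightarrow> real) \<Rightarrow> bool" where
  "mass_function u \<longleftrightarrow> (\<forall>\<sigma>\<in>Omega. 0 \<le> u \<sigma>) \<and> (\<Sum>\<sigma>\<in>Omega. u \<sigma>) = 1"

lemma mass_function_nonneg: "mass_function u \<Longrightarrow> \<sigma> \<in> Omega \<Longrightarrow> 0 \<le> u \<sigma>"
  by (simp add: mass_function_def)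

lemma mass_function_le_1: "mass_function u \<Longrightarrow> \<sigma> \<in> Omega \<Longrightarrow> u \<sigma> \<le> 1"
  unfolding mass_function_def by (metis finite_Omega member_le_sum DiffD1)

context exchange_dynamics
begin

abbreviation "blocks \<equiv> irreducible_components K"

lemma blocks_eq: "blocks = UNIV // {(i, j). 0 < K $ i $ j}\<^sup>*"
  by (rule irreducible_components_eq) (rule K_nonneg)

lemma equiv_connected: "equiv UNIV ({(i, j). 0 < K $ i $ j}\<^sup>*)"
proof -
  have "sym {(i, j). 0 < K $ i $ j}" by (auto simp: sym_def K_sym)
  then show ?thesis by (auto intro!: equivI sym_rtrancl trans_rtrancl refl_rtrancl)
qed

lemma block_ex: "\<exists>A\<in>blocks. l \<in> A"
  unfolding blocks_eq by (metis UNIV_I equiv_connected equiv_class_self quotientI)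

lemma block_nonempty: "A \<in> blocks \<Longrightarrow> A \<noteq> {}"
  unfolding blocks_eq by (rule in_quotient_imp_non_empty[OF equiv_connected])

lemma block_connected: "A \<in> blocks \<Longrightarrow> l \<in> A \<Longrightarrow> k \<in> A \<Longrightarrow> (l, k) \<in> {(i, j). 0 < K $ i $ j}\<^sup>*"
  unfolding blocks_eq by (rule iffD1[OF quotient_eq_iff[OF equiv_connected] refl])

lemma block_edge: "A \<in> blocks \<Longrightarrow> 0 < K $ l $ k \<Longrightarrow> l \<in> A \<longleftrightarrow> k \<in> A"
proof -
  assume A: "A \<in> blocks" and "0 < K $ l $ k"
  then have "(l, k) \<in> {(i, j). 0 < K $ i $ j}\<^sup>*" "(k, l) \<in> {(i, j). 0 < K $ i $ j}\<^sup>*"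
    using K_sym[of l k] by auto
  then show "l \<in> A \<longleftrightarrow> k \<in> A"
    using in_quotient_imp_closed[OF equiv_connected A[unfolded blocks_eq]] by blast
qed

lemma neighbour_ex: "\<exists>k. 0 < K $ l $ k"
proof (rule ccontr)
  assume "\<nexists>k. 0 < K $ l $ k"
  then have "\<not> 0 < K $ l $ k" for k by blast
  then have "K $ l $ k = 0" for k using K_nonneg[of l k] by (simp add: order.strict_iff_order)
  then show False using K_row_sum[of l] by simp
qed

lemma Gamma_part_iff: "h \<in> Gamma_part blocks \<longleftrightarrow> (\<forall>l k. 0 < K $ l $ k \<longrightarrow> h $ l = h $ k)"
proof
  assume "h \<in> Gamma_part blocks"
  then show "\<forall>l k. 0 < K $ l $ k \<longrightarrow> h $ l = h $ k"
  proof (intro allI impI)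
    fix l k assume "0 < K $ l $ k"
    moreover obtain A where "A \<in> blocks" "l \<in> A" using block_ex by blast
    ultimately have "k \<in> A" using block_edge by simp
    from \<open>h \<in> Gamma_part blocks\<close> show "h $ l = h $ k"
      unfolding Gamma_part_def using \<open>A \<in> blocks\<close> \<open>l \<in> A\<close> \<open>k \<in> A\<close> by blast
  qed
next
  assume *: "\<forall>l k. 0 < K $ l $ k \<longrightarrow> h $ l = h $ k"
  have step_path: "h $ l = h $ k" if "(l, k) \<in> {(i, j). 0 < K $ i $ j}\<^sup>*" for l k
    using that
  proof (induction rule: rtrancl_induct)
    case (step j k)
    then have "h $ j = h $ k" using * by blast
    with step.IH show ?case by (rule trans)
  qed simp
  show "h \<in> Gamma_part blocks"
    unfolding Gamma_part_def
  proof (intro CollectI ballI)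
    fix A i j assume "A \<in> blocks" "i \<in> A" "j \<in> A"
    then show "h $ i = h $ j" by (intro step_path block_connected)
  qed
qed

section \<open>Conservation laws and entropy production\<close>

definition dissipation :: "(real ^ 'n \<Rightarrow> real) \<Rightarrow> real" where
  "dissipation u = (\<Sum>l\<in>UNIV. \<Sum>k\<in>UNIV. K $ l $ k * (\<Sum>x\<in>Omega \<times> Omega.
      (flux J u l k x - flux J u l k (exchange l k x))\<^sup>2))"

definition balanced :: "(real ^ 'n \<Rightarrow> real) \<Rightarrow> bool" where
  "balanced u \<longleftrightarrow> (\<forall>l k. 0 < K $ l $ k \<longrightarrow> (\<forall>x\<in>Omega \<times> Omega. flux J u l k (exchange l k x) = flux J u l k x))"

lemma dissipation_nonneg: "0 \<le> dissipation u"
  unfolding dissipation_def by (intro sum_nonneg mult_nonneg_nonneg K_nonneg) auto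

lemma edge_sum_eq_0_iff:
  assumes "\<And>l k x. x \<in> Omega \<times> Omega \<Longrightarrow> 0 \<le> g l k x"
  shows "(\<Sum>l\<in>UNIV. \<Sum>k\<in>UNIV. K $ l $ k * (\<Sum>x\<in>Omega \<times> Omega. g l k x)) = 0 \<longleftrightarrow>
    (\<forall>l k. 0 < K $ l $ k \<longrightarrow> (\<forall>x\<in>Omega \<times> Omega. g l k x = (0::real)))"
proof -
  have "0 \<le> (\<Sum>x\<in>Omega \<times> Omega. g l k x)" for l k
    by (intro sum_nonneg assms)
  then have "(\<Sum>l\<in>UNIV. \<Sum>k\<in>UNIV. K $ l $ k * (\<Sum>x\<in>Omega \<times> Omega. g l k x)) = 0 \<longleftrightarrow>
      (\<forall>l k. K $ l $ k = 0 \<or> (\<Sum>x\<in>Omega \<times> Omega. g l k x) = 0)"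
    by (simp add: sum_nonneg_eq_0_iff sum_nonneg K_nonneg)
  moreover have "(\<Sum>x\<in>Omega \<times> Omega. g l k x) = 0 \<longleftrightarrow> (\<forall>x\<in>Omega \<times> Omega. g l k x = 0)" for l k
    by (rule sum_nonneg_eq_0_iff) (auto simp: finite_Omega assms)
  moreover have "(K $ l $ k = 0 \<or> Q) \<longleftrightarrow> (0 < K $ l $ k \<longrightarrow> Q)" for l k Q
    using K_nonneg[of l k] by (auto simp: order.strict_iff_order)
  ultimately show ?thesis by simp
qed

lemma dissipation_eq_0_iff: "dissipation u = 0 \<longleftrightarrow> balanced u"
  unfolding dissipation_def balanced_def by (subst edge_sum_eq_0_iff) auto

lemma weak_form_eq_0:
  assumes u: "mass_function u"
    and "\<And>l k x. 0 < K $ l $ k \<Longrightarrow> x \<in> Omega \<times> Omega \<Longrightarrow>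
      (flux J u l k x - flux J u l k (exchange l k x)) * (pair_sum \<phi> x - pair_sum \<phi> (exchange l k x)) = 0"
  shows "(\<Sum>\<tau>\<in>Omega. (collide J K u u \<tau> - u \<tau>) * \<phi> \<tau>) = 0"
proof -
  have "K $ l $ k * (\<Sum>x\<in>Omega \<times> Omega.
      (flux J u l k x - flux J u l k (exchange l k x)) * (pair_sum \<phi> x - pair_sum \<phi> (exchange l k x))) = 0" for l k
  proof (cases "K $ l $ k = 0")
    case False
    then have "0 < K $ l $ k" using K_nonneg[of l k] by linarith
    then have "(\<Sum>x\<in>Omega \<times> Omega. (flux J u l k x - flux J u l k (exchange l k x)) *
        (pair_sum \<phi> x - pair_sum \<phi> (exchange l k x))) = 0"
      by (intro sum.neutral ballI assms(2))
    then show ?thesis by simp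
  qed simp
  then have "(\<Sum>l\<in>UNIV. \<Sum>k\<in>UNIV. K $ l $ k * (\<Sum>x\<in>Omega \<times> Omega.
      (flux J u l k x - flux J u l k (exchange l k x)) * (pair_sum \<phi> x - pair_sum \<phi> (exchange l k x)))) = 0"
    by (intro sum.neutral ballI)
  then show ?thesis using u symmetrised_weak_form[of u \<phi>] by (simp add: mass_function_def)
qed

lemma balanced_collide:
  assumes u: "mass_function u" and "balanced u" and \<tau>: "\<tau> \<in> Omega"
  shows "collide J K u u \<tau> = u \<tau>"
proof -
  have "(\<Sum>\<sigma>\<in>Omega. (collide J K u u \<sigma> - u \<sigma>) * of_bool (\<sigma> = \<tau>)) = 0"
  proof (rule weak_form_eq_0[OF u])
    fix l k and x :: "(real ^ 'n) \<times> (real ^ 'n)"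
    assume "0 < K $ l $ k" "x \<in> Omega \<times> Omega"
    then have "flux J u l k (exchange l k x) = flux J u l k x"
      using \<open>balanced u\<close>[unfolded balanced_def, rule_format] by (simp only:)
    then show "(flux J u l k x - flux J u l k (exchange l k x)) *
        (pair_sum (\<lambda>\<sigma>. of_bool (\<sigma> = \<tau>)) x - pair_sum (\<lambda>\<sigma>. of_bool (\<sigma> = \<tau>)) (exchange l k x)) = 0"
      by simp
  qed
  moreover have "(\<Sum>\<sigma>\<in>Omega. (collide J K u u \<sigma> - u \<sigma>) * of_bool (\<sigma> = \<tau>)) = collide J K u u \<tau> - u \<tau>"
  proof -
    have "(\<Sum>\<sigma>\<in>Omega. (collide J K u u \<sigma> - u \<sigma>) * of_bool (\<sigma> = \<tau>))
        = (\<Sum>\<sigma>\<in>Omega. if \<sigma> = \<tau> then collide J K u u \<tau> - u \<tau> else 0)"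
      by (rule sum.cong[OF refl]) (simp only: of_bool_def split: if_splits, simp)
    then show ?thesis using \<tau> by (simp add: finite_Omega)
  qed
  ultimately show ?thesis by simp
qed

lemma balanced_ising: "h \<in> Gamma_part blocks \<Longrightarrow> balanced (pmf (ising J h))"
  unfolding balanced_def Gamma_part_iff by (intro allI impI ballI detailed_balance) blast+

text \<open>Exchanging spins between sites of equal weight does not change the weighted total over both
  particles.\<close>
lemma linear_conserved:
  assumes u: "mass_function u" and g: "\<And>l k. 0 < K $ l $ k \<Longrightarrow> g l = g k"
  shows "(\<Sum>\<tau>\<in>Omega. (collide J K u u \<tau> - u \<tau>) * (\<Sum>i\<in>UNIV. g i * \<tau> $ i)) = 0"
proof (rule weak_form_eq_0[OF u])
  fix l k and x :: "(real ^ 'n) \<times> (real ^ 'n)"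
  assume "0 < K $ l $ k"
  from linear_exchange[OF g[OF this], of x]
  show "(flux J u l k x - flux J u l k (exchange l k x)) * (pair_sum (\<lambda>\<tau>. \<Sum>i\<in>UNIV. g i * \<tau> $ i) x
      - pair_sum (\<lambda>\<tau>. \<Sum>i\<in>UNIV. g i * \<tau> $ i) (exchange l k x)) = 0"
    by simp
qed

text \<open>The acceptance probability cancels between the two fluxes. If the second flux is invariant
  under an exchange, increments of the left-hand side are those of \<open>ln (flux J u l k)\<close>.\<close>
lemma log_flux:
  assumes pos: "\<forall>\<sigma>\<in>Omega. 0 < u \<sigma>" and x: "x \<in> Omega \<times> Omega"
  shows "pair_sum (\<lambda>\<sigma>. ln (u \<sigma>) - ln (pmf (ising J h) \<sigma>)) x
    = ln (flux J u l k x) - ln (flux J (pmf (ising J h)) l k x)"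
proof -
  have "fst x \<in> Omega" "snd x \<in> Omega" using x by (simp_all add: mem_Times_iff)
  then have "0 < u (fst x)" "0 < u (snd x)" "0 < pmf (ising J h) (fst x)" "0 < pmf (ising J h) (snd x)"
    using pos by (blast intro: pmf_ising_pos)+
  then show ?thesis
    using swap_prob_pos[OF x, of J l k] by (simp add: flux_def pair_mass_def ln_mult_pos)
qed

text \<open>The H-theorem: each term of the symmetrised weak form is \<open>(a - b) (ln a - ln b)\<close> for the two
  opposite fluxes \<open>a, b \<in> (0, 1]\<close>.\<close>
lemma entropy_production:
  assumes u: "mass_function u" and pos: "\<And>\<sigma>. \<sigma> \<in> Omega \<Longrightarrow> 0 < u \<sigma>" and h: "h \<in> Gamma_part blocks"
  shows "(\<Sum>\<tau>\<in>Omega. (collide J K u u \<tau> - u \<tau>) * (ln (u \<tau>) - ln (pmf (ising J h) \<tau>)))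
     \<le> - dissipation u / (4 * real CARD('n))"
proof -
  let ?\<phi> = "\<lambda>\<sigma>. ln (u \<sigma>) - ln (pmf (ising J h) \<sigma>)"
  have flux_range: "0 < flux J u l k x" "flux J u l k x \<le> 1" if "x \<in> Omega \<times> Omega" for l k x
    using that swap_prob_pos[OF that, of J l k] swap_prob_le_1[of J l k] pos mass_function_le_1[OF u]
    unfolding flux_def pair_mass_def by (auto intro!: mult_le_one mult_pos_pos simp: less_imp_le)
  have "(flux J u l k x - flux J u l k (exchange l k x))\<^sup>2
      \<le> (flux J u l k x - flux J u l k (exchange l k x)) * (pair_sum ?\<phi> x - pair_sum ?\<phi> (exchange l k x))"
    if "0 < K $ l $ k" "x \<in> Omega \<times> Omega" for l k x
  proof -
    have y: "exchange l k x \<in> Omega \<times> Omega" using that(2) by (rule exchange_in_Omega)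
    have "h $ l = h $ k" using h that(1) by (simp add: Gamma_part_iff)
    then have "flux J (pmf (ising J h)) l k (exchange l k x) = flux J (pmf (ising J h)) l k x"
      using that(2) by (rule detailed_balance)
    then have "ln (flux J (pmf (ising J h)) l k (exchange l k x)) = ln (flux J (pmf (ising J h)) l k x)"
      by simp
    moreover have pos': "\<forall>\<sigma>\<in>Omega. 0 < u \<sigma>" using pos by blast
    ultimately have "pair_sum ?\<phi> x - pair_sum ?\<phi> (exchange l k x) = ln (flux J u l k x) - ln (flux J u l k (exchange l k x))"
      using log_flux[OF pos' that(2), of h l k] log_flux[OF pos' y, of h l k] by linarith
    then show ?thesis using diff_mult_ln_diff_ge[OF flux_range[OF that(2)] flux_range[OF y]] by simp
  qed
  then have "dissipation u \<le> (\<Sum>l\<in>UNIV. \<Sum>k\<in>UNIV. K $ l $ k * (\<Sum>x\<in>Omega \<times> Omega.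
        (flux J u l k x - flux J u l k (exchange l k x)) * (pair_sum ?\<phi> x - pair_sum ?\<phi> (exchange l k x))))"
    unfolding dissipation_def
    by (intro sum_mono) (metis (no_types, lifting) K_nonneg mult_left_mono mult_zero_left order.strict_iff_order order_refl sum_mono)
  then show ?thesis
    using u unfolding mass_function_def by (simp only: symmetrised_weak_form) (simp add: divide_right_mono)
qed

text \<open>Test against the indicator of the complement of the support. A flux at \<open>x\<close> vanishes whenever
  a component of \<open>x\<close> lies outside the support, so only the mixed products survive; they all have the same
  sign while their total is zero, so each one vanishes.\<close>
lemma support_closed_under_exchange:
  assumes u: "mass_function u" and vanish: "\<And>\<tau>. \<tau> \<in> Omega \<Longrightarrow> u \<tau> = 0 \<Longrightarrow> collide J K u u \<tau> = 0"
    and edge: "0 < K $ l $ k" and x: "x \<in> Omega \<times> Omega" and "pair_mass u x \<noteq> 0"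
  shows "pair_mass u (exchange l k x) \<noteq> 0"
proof -
  let ?\<phi> = "\<lambda>\<sigma>. of_bool (u \<sigma> = 0)"
  let ?g = "\<lambda>l k x. flux J u l k x * pair_sum ?\<phi> (exchange l k x) + flux J u l k (exchange l k x) * pair_sum ?\<phi> x"
  have nn: "0 \<le> flux J u l k y" if "y \<in> Omega \<times> Omega" for l k y
    using that mass_function_nonneg[OF u] by (auto simp: flux_def pair_mass_def swap_prob_nonneg)
  have null: "flux J u l k y * pair_sum ?\<phi> y = 0" for l k y
    by (simp add: flux_def pair_mass_def)
  have "(flux J u l k y - flux J u l k (exchange l k y)) * (pair_sum ?\<phi> y - pair_sum ?\<phi> (exchange l k y)) = - ?g l k y"
    for l k y
    using null[of l k y] null[of l k "exchange l k y"] unfolding left_diff_distrib right_diff_distrib by linarith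
  moreover have "(\<Sum>\<tau>\<in>Omega. (collide J K u u \<tau> - u \<tau>) * ?\<phi> \<tau>) = 0"
    by (intro sum.neutral) (auto simp: vanish)
  ultimately have "(\<Sum>l\<in>UNIV. \<Sum>k\<in>UNIV. K $ l $ k * (\<Sum>x\<in>Omega \<times> Omega. - ?g l k x)) = 0"
    using symmetrised_weak_form[of u ?\<phi>] u unfolding mass_function_def by simp
  then have "(\<Sum>l\<in>UNIV. \<Sum>k\<in>UNIV. K $ l $ k * (\<Sum>x\<in>Omega \<times> Omega. ?g l k x)) = 0"
    by (simp only: sum_negf mult_minus_right neg_equal_0_iff_equal)
  moreover have "(\<Sum>l\<in>UNIV. \<Sum>k\<in>UNIV. K $ l $ k * (\<Sum>x\<in>Omega \<times> Omega. ?g l k x)) = 0 \<longleftrightarrow>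
      (\<forall>l k. 0 < K $ l $ k \<longrightarrow> (\<forall>x\<in>Omega \<times> Omega. ?g l k x = 0))"
    by (rule edge_sum_eq_0_iff) (intro add_nonneg_nonneg mult_nonneg_nonneg nn exchange_in_Omega, auto)
  ultimately have "?g l k x = 0"
    using edge x by blast
  moreover have "0 < flux J u l k x"
    using nn[OF x, of l k] \<open>pair_mass u x \<noteq> 0\<close> swap_prob_pos[OF x, of J l k]
    by (simp add: order.strict_iff_order flux_def)
  moreover have "0 \<le> flux J u l k (exchange l k x) * pair_sum ?\<phi> x"
    using nn[OF exchange_in_Omega[OF x]] by simp
  ultimately have "pair_sum ?\<phi> (exchange l k x) \<le> 0"
    by (smt (verit, best) mult_pos_pos)
  then have "u (fst (exchange l k x)) \<noteq> 0 \<and> u (snd (exchange l k x)) \<noteq> 0"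
    unfolding of_bool_def by (smt (verit))
  then show ?thesis by (simp add: pair_mass_def)
qed

end

section \<open>Mean spins and relative entropy\<close>

text \<open>The magnetization of \<open>A\<close>, with the sum over \<open>A\<close> written as a linear functional with
  weights \<open>of_bool (i \<in> A)\<close> so that the conservation law applies literally.\<close>
definition mean_spin :: "(real ^ 'n \<Rightarrow> real) \<Rightarrow> 'n::finite set \<Rightarrow> real" where
  "mean_spin u A = (\<Sum>\<sigma>\<in>Omega. u \<sigma> * (\<Sum>i\<in>UNIV. of_bool (i \<in> A) * \<sigma> $ i)) / real (card A)"

lemma mag_eq_mean_spin:
  fixes p :: "(real ^ 'n::finite) pmf"
  assumes "p \<in> Prob"
  shows "mag p A = mean_spin (pmf p) A"
proof -
  have "measure_pmf.expectation p (\<lambda>\<sigma>. \<sigma> $ l) = (\<Sum>\<sigma>\<in>Omega. pmf p \<sigma> * \<sigma> $ l)" for l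
    using assms by (subst integral_measure_pmf[of Omega]) (auto simp: finite_Omega Prob_def)
  then have "mag p A = (\<Sum>l\<in>A. \<Sum>\<sigma>\<in>Omega. pmf p \<sigma> * \<sigma> $ l) / real (card A)"
    by (simp add: mag_def)
  also have "(\<Sum>l\<in>A. \<Sum>\<sigma>\<in>Omega. pmf p \<sigma> * \<sigma> $ l) = (\<Sum>\<sigma>\<in>Omega. pmf p \<sigma> * (\<Sum>l\<in>A. \<sigma> $ l))"
    by (subst sum.swap) (simp add: sum_distrib_left)
  also have "\<dots> = (\<Sum>\<sigma>\<in>Omega. pmf p \<sigma> * (\<Sum>i\<in>UNIV. of_bool (i \<in> A) * \<sigma> $ i))"
    by simp
  finally show ?thesis by (simp only: mean_spin_def)
qed

lemma mass_function_pmf: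
  assumes "p \<in> Prob" shows "mass_function (pmf p)"
proof -
  have "(\<Sum>\<sigma>\<in>Omega. pmf p \<sigma>) = 1"
    using assms finite_Omega unfolding Prob_def by (intro sum_pmf_eq_1) auto
  then show ?thesis by (simp add: mass_function_def)
qed

lemma ising_in_Prob: "ising J h \<in> Prob"
  by (simp add: Prob_def set_pmf_ising)

lemma mass_function_ising: "mass_function (pmf (ising J h))"
  by (rule mass_function_pmf[OF ising_in_Prob])

lemma pmf_eq_on_Omega:
  assumes "p \<in> Prob" "q \<in> Prob" "\<And>\<sigma>. \<sigma> \<in> Omega \<Longrightarrow> pmf p \<sigma> = pmf q \<sigma>"
  shows "p = q"
proof (rule pmf_eqI)
  fix \<sigma> show "pmf p \<sigma> = pmf q \<sigma>"
  proof (cases "\<sigma> \<in> Omega")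
    case False
    then have "\<sigma> \<notin> set_pmf p" "\<sigma> \<notin> set_pmf q" using assms unfolding Prob_def by auto
    then show ?thesis by (simp add: set_pmf_eq)
  qed (rule assms(3))
qed

text \<open>Otherwise every configuration in the support is constantly \<open>- a\<close> on \<open>A\<close>.\<close>
lemma support_meets_both_spins:
  assumes u: "mass_function u" and "A \<noteq> {}" and mean: "\<bar>mean_spin u A\<bar> \<noteq> 1" and a: "a \<in> {-1, 1}"
  shows "\<exists>\<sigma>\<in>Omega. u \<sigma> \<noteq> 0 \<and> (\<exists>i\<in>A. \<sigma> $ i = a)"
proof (rule ccontr)
  assume neg: "\<not> ?thesis"
  have card: "real (card A) > 0" using \<open>A \<noteq> {}\<close> by (simp add: card_gt_0_iff)
  have "u \<sigma> * (\<Sum>i\<in>UNIV. of_bool (i \<in> A) * \<sigma> $ i) = u \<sigma> * (- a * real (card A))" if "\<sigma> \<in> Omega" for \<sigma>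
  proof (cases "u \<sigma> = 0")
    case False
    then have "\<sigma> $ i = - a" if "i \<in> A" for i
      using that neg Omega_nth[OF \<open>\<sigma> \<in> Omega\<close>, of i] a \<open>\<sigma> \<in> Omega\<close> by auto
    then have "(\<Sum>i\<in>UNIV. of_bool (i \<in> A) * \<sigma> $ i) = (\<Sum>i\<in>A. - a)"
      by (intro sum.mono_neutral_cong_right) auto
    then show ?thesis by simp
  qed simp
  then have "(\<Sum>\<sigma>\<in>Omega. u \<sigma> * (\<Sum>i\<in>UNIV. of_bool (i \<in> A) * \<sigma> $ i))
      = (\<Sum>\<sigma>\<in>Omega. u \<sigma>) * (- a * real (card A))"
    unfolding sum_distrib_right by (intro sum.cong refl)
  then have "mean_spin u A = - a" using card u \<open>A \<noteq> {}\<close> unfolding mean_spin_def mass_function_def by simp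
  with mean a show False by auto
qed

definition rel_entropy :: "(real ^ 'n::finite \<Rightarrow> real) \<Rightarrow> (real ^ 'n \<Rightarrow> real) \<Rightarrow> real" where
  "rel_entropy u v = (\<Sum>\<sigma>\<in>Omega. u \<sigma> * (ln (u \<sigma>) - ln (v \<sigma>)))"

text \<open>Pointwise, \<open>ln y \<le> y - 1\<close> at \<open>y = sqrt (b / a)\<close>. Points with \<open>u \<sigma> = 0\<close> contribute
  \<open>0\<close> to the entropy because \<open>ln 0 = 0\<close>, which agrees with the convention \<open>0 ln 0 = 0\<close>.\<close>
lemma rel_entropy_ge_hellinger:
  assumes u: "mass_function u" and v: "mass_function v" and v_pos: "\<And>\<sigma>. \<sigma> \<in> Omega \<Longrightarrow> 0 < v \<sigma>"
  shows "(\<Sum>\<sigma>\<in>Omega. (sqrt (u \<sigma>) - sqrt (v \<sigma>))\<^sup>2) \<le> rel_entropy u v"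
proof -
  have pointwise: "(sqrt a - sqrt b)\<^sup>2 \<le> a * (ln a - ln b) - a + b" if "0 \<le> a" "0 < b" for a b :: real
  proof (cases "a = 0")
    case False
    then have a: "0 < a" using that by simp
    have "ln (sqrt b / sqrt a) \<le> sqrt b / sqrt a - 1" using a that by (intro ln_le_minus_one) simp
    then have "ln b - ln a \<le> 2 * (sqrt b / sqrt a - 1)" using a that by (simp add: ln_div ln_sqrt)
    then have "a * (ln b - ln a) \<le> a * (2 * (sqrt b / sqrt a - 1))" using a by (intro mult_left_mono) auto
    moreover have "a * (2 * (sqrt b / sqrt a - 1)) = 2 * (a * (sqrt b / sqrt a)) - 2 * a"
      by (simp add: algebra_simps)
    moreover have "a * (sqrt b / sqrt a) = sqrt a * sqrt b" using a by (simp add: real_div_sqrt field_simps)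
    moreover have "(sqrt a - sqrt b)\<^sup>2 = a + b - 2 * (sqrt a * sqrt b)" using that by (simp add: power2_diff)
    moreover have "a * (ln a - ln b) = - (a * (ln b - ln a))" by (simp add: algebra_simps)
    ultimately show ?thesis by linarith
  qed (use that in simp)
  have "(\<Sum>\<sigma>\<in>Omega. (sqrt (u \<sigma>) - sqrt (v \<sigma>))\<^sup>2) \<le> (\<Sum>\<sigma>\<in>Omega. u \<sigma> * (ln (u \<sigma>) - ln (v \<sigma>)) - u \<sigma> + v \<sigma>)"
    using mass_function_nonneg[OF u] v_pos by (intro sum_mono pointwise)
  also have "\<dots> = rel_entropy u v"
    using u v by (simp add: rel_entropy_def mass_function_def sum.distrib sum_subtractf)
  finally show ?thesis .
qed

context exchange_dynamics
begin

text \<open>Let \<open>S\<close> be the support. Exchanging \<open>\<sigma>\<^sub>l\<close> with \<open>\<sigma>'\<^sub>k\<close> copies onto \<open>l\<close> any spin value attained at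
  \<open>k\<close> within \<open>S\<close>, so a value attained somewhere in a component is attained at all its sites. Both values
  are attained, and each site has a neighbour (possibly itself) to copy from; so every single
  spin change stays in \<open>S\<close>.\<close>
lemma full_support:
  assumes u: "mass_function u"
    and closed: "\<And>l k x. 0 < K $ l $ k \<Longrightarrow> x \<in> Omega \<times> Omega \<Longrightarrow> pair_mass u x \<noteq> 0 \<Longrightarrow> pair_mass u (exchange l k x) \<noteq> 0"
    and mean: "\<And>A. A \<in> blocks \<Longrightarrow> \<bar>mean_spin u A\<bar> \<noteq> 1"
    and \<sigma>: "\<sigma> \<in> Omega"
  shows "0 < u \<sigma>"
proof -
  define S where "S = {\<sigma> \<in> Omega. u \<sigma> \<noteq> 0}"
  have inherit: "set_spin l \<sigma> (\<sigma>' $ k) \<in> S" if "0 < K $ l $ k" "\<sigma> \<in> S" "\<sigma>' \<in> S" for l k \<sigma> \<sigma>'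
    using closed[OF that(1), of "(\<sigma>, \<sigma>')"] exchange_in_Omega[of "(\<sigma>, \<sigma>')" l k] that(2,3)
    by (auto simp: S_def exchange_def pair_mass_def)
  have spread: "\<exists>\<sigma>\<in>S. \<sigma> $ l = a" if "(i, l) \<in> {(i, j). 0 < K $ i $ j}\<^sup>*" "\<exists>\<sigma>\<in>S. \<sigma> $ i = a" for i l a
    using that
  proof (induction rule: rtrancl_induct)
    case (step j l)
    then obtain \<sigma>' where "\<sigma>' \<in> S" "\<sigma>' $ j = a" by blast
    moreover have "0 < K $ l $ j" using step.hyps K_sym by simp
    ultimately have "set_spin l \<sigma>' (\<sigma>' $ j) \<in> S" using inherit by blast
    then show ?case using \<open>\<sigma>' $ j = a\<close> by (intro bexI[of _ "set_spin l \<sigma>' (\<sigma>' $ j)"]) auto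
  qed
  have attained: "\<exists>\<sigma>\<in>S. \<sigma> $ l = a" if a: "a \<in> {-1, 1}" for l a
  proof -
    obtain A where A: "A \<in> blocks" "l \<in> A" using block_ex by blast
    then obtain \<sigma> i where "\<sigma> \<in> S" "i \<in> A" "\<sigma> $ i = a"
      using support_meets_both_spins[OF u block_nonempty mean a] unfolding S_def by blast
    moreover have "(i, l) \<in> {(i, j). 0 < K $ i $ j}\<^sup>*"
      using block_connected A \<open>i \<in> A\<close> by blast
    ultimately show ?thesis using spread by blast
  qed
  have "set_spin l \<sigma> a \<in> S" if "\<sigma> \<in> S" "a \<in> {-1, 1}" for l \<sigma> a
    using neighbour_ex[of l] attained[OF that(2)] inherit[OF _ that(1)] by metis
  moreover obtain \<sigma>\<^sub>0 where "\<sigma>\<^sub>0 \<in> S" using attained[of 1] by auto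
  ultimately have "\<sigma> \<in> S" using single_spin_changes_connect[of \<sigma>\<^sub>0 S] \<sigma> by blast
  then show ?thesis using mass_function_nonneg[OF u \<sigma>] by (simp add: S_def)
qed

lemma balanced_full_support:
  assumes u: "mass_function u" and bal: "balanced u"
    and mean: "\<And>A. A \<in> blocks \<Longrightarrow> \<bar>mean_spin u A\<bar> \<noteq> 1" and \<sigma>: "\<sigma> \<in> Omega"
  shows "0 < u \<sigma>"
proof (rule full_support[OF u _ mean \<sigma>])
  fix l k and x :: "(real ^ 'n) \<times> (real ^ 'n)"
  assume *: "0 < K $ l $ k" "x \<in> Omega \<times> Omega" "pair_mass u x \<noteq> 0"
  have "flux J u l k (exchange l k x) = flux J u l k x"
    using bal[unfolded balanced_def, rule_format, OF *(1,2)] .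
  moreover have "flux J u l k x \<noteq> 0"
    using *(3) swap_prob_pos[OF *(2), of J l k] by (simp add: flux_def)
  ultimately show "pair_mass u (exchange l k x) \<noteq> 0" by (auto simp: flux_def)
qed

text \<open>With \<open>g = ln (u / \<mu>\<^sub>J)\<close>, balance says that \<open>g \<sigma> + g \<sigma>'\<close> is invariant under exchanges along
  edges. Exchanging \<open>\<sigma>\<^sub>l = 1\<close> with \<open>\<sigma>'\<^sub>k = -1\<close> shows that the increment of \<open>g\<close> under raising spin \<open>l\<close>
  in \<open>\<sigma>\<close> equals the one under raising spin \<open>k\<close> in \<open>\<sigma>'\<close>, for independent \<open>\<sigma>\<close> and \<open>\<sigma>'\<close>. So increments
  do not depend on the configuration, they agree along edges, and \<open>g\<close> is affine in the spins.\<close>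
lemma balanced_positive_is_ising:
  assumes u: "mass_function u" and pos: "\<And>\<sigma>. \<sigma> \<in> Omega \<Longrightarrow> 0 < u \<sigma>" and bal: "balanced u"
  shows "\<exists>h\<in>Gamma_part blocks. \<forall>\<sigma>\<in>Omega. u \<sigma> = pmf (ising J h) \<sigma>"
proof -
  define g where "g \<sigma> = ln (u \<sigma>) - ln (pmf (ising J 0) \<sigma>)" for \<sigma>
  define \<sigma>\<^sub>0 :: "real ^ 'n" where "\<sigma>\<^sub>0 = (\<chi> i. 1)"
  define D where "D l \<sigma> = g (set_spin l \<sigma> 1) - g (set_spin l \<sigma> (-1))" for l \<sigma>
  \<comment> \<open>Raising spin \<open>l\<close> from \<open>-1\<close> to \<open>1\<close> changes \<open>\<Sum>\<^sub>i h\<^sub>i \<sigma>\<^sub>i\<close> by \<open>2 h\<^sub>l\<close>.\<close>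
  define h where "h = (\<chi> l. D l \<sigma>\<^sub>0 / 2)"
  have \<sigma>\<^sub>0: "\<sigma>\<^sub>0 \<in> Omega" by (simp add: \<sigma>\<^sub>0_def Omega_def)
  have pos': "\<forall>\<sigma>\<in>Omega. 0 < u \<sigma>" using pos by blast
  have inv: "pair_sum g (exchange l k x) = pair_sum g x" if "0 < K $ l $ k" "x \<in> Omega \<times> Omega" for l k x
  proof -
    have "flux J u l k (exchange l k x) = flux J u l k x"
      using bal[unfolded balanced_def, rule_format, OF that] .
    moreover have "flux J (pmf (ising J 0)) l k (exchange l k x) = flux J (pmf (ising J 0)) l k x"
      using that by (intro detailed_balance) auto
    ultimately show ?thesis
      using log_flux[OF pos' that(2), of 0 l k] log_flux[OF pos' exchange_in_Omega[OF that(2), of l k], of 0 l k]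
      unfolding g_def by simp
  qed
  have D_eq: "D l \<sigma> = D k \<sigma>'" if edge: "0 < K $ l $ k" and "\<sigma> \<in> Omega" "\<sigma>' \<in> Omega" for l k \<sigma> \<sigma>'
  proof -
    have "exchange l k (set_spin l \<sigma> 1, set_spin k \<sigma>' (-1)) = (set_spin l \<sigma> (-1), set_spin k \<sigma>' 1)"
      by (simp add: exchange_def vec_eq_iff)
    moreover have "(set_spin l \<sigma> 1, set_spin k \<sigma>' (-1)) \<in> Omega \<times> Omega"
      using that by (auto intro!: set_spin_in_Omega)
    ultimately show ?thesis using inv[OF edge, of "(set_spin l \<sigma> 1, set_spin k \<sigma>' (-1))"] by (simp add: D_def)
  qed
  have D: "D l \<sigma> = 2 * h $ l" if "\<sigma> \<in> Omega" for l \<sigma>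
  proof -
    obtain k where "0 < K $ l $ k" using neighbour_ex by blast
    from D_eq[OF this that \<sigma>\<^sub>0] D_eq[OF this \<sigma>\<^sub>0 \<sigma>\<^sub>0] show ?thesis by (simp add: h_def)
  qed
  have h: "h \<in> Gamma_part blocks"
    unfolding Gamma_part_iff
  proof (intro allI impI)
    fix l k assume "0 < K $ l $ k"
    from D_eq[OF this \<sigma>\<^sub>0 \<sigma>\<^sub>0] show "h $ l = h $ k" by (simp add: h_def)
  qed
  define r where "r \<sigma> = g \<sigma> - (\<Sum>i\<in>UNIV. h $ i * \<sigma> $ i)" for \<sigma>
  have r_flip: "r (set_spin l \<sigma> a) = r \<sigma>" if "\<sigma> \<in> Omega" "a \<in> {-1, 1}" for l \<sigma> a
  proof -
    have "r (set_spin l \<sigma> 1) = r (set_spin l \<sigma> (-1))"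
      using D[OF that(1), of l] by (simp add: r_def D_def linear_set_spin algebra_simps del: set_spin_nth)
    then have flip: "r (set_spin l \<sigma> b) = r (set_spin l \<sigma> 1)" if "b \<in> {-1, 1}" for b
      using that by auto
    have "set_spin l \<sigma> (\<sigma> $ l) = \<sigma>" by (simp add: vec_eq_iff)
    with flip[OF that(2)] flip[OF Omega_nth[OF that(1)], of l] show ?thesis by simp
  qed
  have "Omega \<subseteq> {\<sigma> \<in> Omega. r \<sigma> = r \<sigma>\<^sub>0}"
    by (rule single_spin_changes_connect[of \<sigma>\<^sub>0]) (auto simp: \<sigma>\<^sub>0 r_flip set_spin_in_Omega)
  then have r: "r \<sigma> = r \<sigma>\<^sub>0" if "\<sigma> \<in> Omega" for \<sigma> using that by blast
  \<comment> \<open>So far \<open>u\<close> is a multiple of the Ising measure; the total masses identify the factor as \<open>1\<close>.\<close>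
  define C where "C = exp (r \<sigma>\<^sub>0) * ising_Z J h / ising_Z J 0"
  have uC: "u \<sigma> = C * pmf (ising J h) \<sigma>" if "\<sigma> \<in> Omega" for \<sigma>
  proof -
    have "u \<sigma> = exp (g \<sigma>) * pmf (ising J 0) \<sigma>"
      using pos[OF that] pmf_ising_pos[OF that, of J 0] by (simp add: g_def exp_diff)
    also have "g \<sigma> = r \<sigma>\<^sub>0 + (\<Sum>i\<in>UNIV. h $ i * \<sigma> $ i)" using r[OF that] by (simp add: r_def)
    finally show ?thesis using ising_Z_pos[of J h] ising_Z_pos[of J 0]
      by (simp add: pmf_ising_field[OF that, of J h] C_def exp_add)
  qed
  have "C = 1"
    using u mass_function_ising[of J h] by (simp add: mass_function_def uC flip: sum_distrib_left)
  with uC h show ?thesis by auto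
qed

text \<open>A linear functional with weights constant on blocks is a combination of the block means.\<close>
lemma linear_mean_eq:
  assumes mean: "\<And>A. A \<in> blocks \<Longrightarrow> mean_spin u A = mean_spin v A"
    and h: "h \<in> Gamma_part blocks"
  shows "(\<Sum>\<sigma>\<in>Omega. u \<sigma> * (\<Sum>i\<in>UNIV. h $ i * \<sigma> $ i)) = (\<Sum>\<sigma>\<in>Omega. v \<sigma> * (\<Sum>i\<in>UNIV. h $ i * \<sigma> $ i))"
proof -
  define m where "m w i = (\<Sum>\<sigma>\<in>Omega. w \<sigma> * \<sigma> $ i)" for w and i :: 'n
  have linear: "(\<Sum>\<sigma>\<in>Omega. w \<sigma> * (\<Sum>i\<in>UNIV. g i * \<sigma> $ i)) = (\<Sum>i\<in>UNIV. g i * m w i)" for w g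
    unfolding m_def sum_distrib_left by (subst sum.swap) (simp add: mult_ac)
  have block: "(\<Sum>i\<in>A. h $ i * m u i) = (\<Sum>i\<in>A. h $ i * m v i)" if A: "A \<in> blocks" for A
  proof -
    have "real (card A) \<noteq> 0" using block_nonempty[OF A] by simp
    then have eq: "(\<Sum>i\<in>A. m u i) = (\<Sum>i\<in>A. m v i)"
      using mean[OF A] unfolding mean_spin_def linear by simp
    obtain j where "j \<in> A" using block_nonempty[OF A] by blast
    then have "h $ i = h $ j" if "i \<in> A" for i
      using h A that unfolding Gamma_part_def by blast
    then have "(\<Sum>i\<in>A. h $ i * m w i) = h $ j * (\<Sum>i\<in>A. m w i)" for w
      unfolding sum_distrib_left by (intro sum.cong refl) (simp only:)
    with eq show ?thesis by simp
  qed
  have "\<Union>blocks = UNIV" using block_ex by blast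
  then have "(\<Sum>i\<in>UNIV. f i) = (\<Sum>A\<in>blocks. \<Sum>i\<in>A. f i)" for f :: "'n \<Rightarrow> real"
    using sum.Union_disjoint[of blocks f] quotient_disj[OF equiv_connected]
    by (auto simp: blocks_eq)
  then show ?thesis unfolding linear using block by simp
qed

text \<open>On \<^const>\<open>Omega\<close>, \<open>ln a - ln b\<close> for the two Ising measures \<open>a, b\<close> is a constant plus a linear
  functional with weights \<open>h - h'\<close>. Equal means make its pairing with \<open>a - b\<close> vanish, whereas every
  summand \<open>(a - b) (ln a - ln b)\<close> dominates \<open>(a - b)\<^sup>2\<close>.\<close>
lemma field_unique:
  assumes h: "h \<in> Gamma_part blocks" and h': "h' \<in> Gamma_part blocks"
    and mean: "\<And>A. A \<in> blocks \<Longrightarrow> mean_spin (pmf (ising J h)) A = mean_spin (pmf (ising J h')) A"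
  shows "h = h'"
proof -
  let ?a = "pmf (ising J h)" and ?b = "pmf (ising J h')"
  define G where "G \<sigma> = (\<Sum>i\<in>UNIV. (h - h') $ i * \<sigma> $ i)" for \<sigma> :: "real ^ 'n"
  define c where "c = ln (ising_Z J h') - ln (ising_Z J h)"
  have log: "ln (?a \<sigma>) - ln (?b \<sigma>) = G \<sigma> + c" if "\<sigma> \<in> Omega" for \<sigma>
    using that ising_Z_pos[of J h] ising_Z_pos[of J h']
    by (simp add: pmf_ising ising_weight_def G_def c_def ln_div algebra_simps sum_subtractf)
  have "h - h' \<in> Gamma_part blocks" using h h' by (auto simp: Gamma_part_iff)
  then have "(\<Sum>\<sigma>\<in>Omega. ?a \<sigma> * G \<sigma>) = (\<Sum>\<sigma>\<in>Omega. ?b \<sigma> * G \<sigma>)"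
    unfolding G_def by (intro linear_mean_eq mean)
  moreover have "(\<Sum>\<sigma>\<in>Omega. ?a \<sigma>) = (\<Sum>\<sigma>\<in>Omega. ?b \<sigma>)"
    using mass_function_ising[of J h] mass_function_ising[of J h'] by (simp add: mass_function_def)
  ultimately have "(\<Sum>\<sigma>\<in>Omega. (?a \<sigma> - ?b \<sigma>) * (G \<sigma> + c)) = 0"
    by (simp add: left_diff_distrib distrib_left sum.distrib sum_subtractf flip: sum_distrib_right)
  then have "(\<Sum>\<sigma>\<in>Omega. (?a \<sigma> - ?b \<sigma>) * (ln (?a \<sigma>) - ln (?b \<sigma>))) = 0"
    by (simp add: log)
  moreover have "(?a \<sigma> - ?b \<sigma>)\<^sup>2 \<le> (?a \<sigma> - ?b \<sigma>) * (ln (?a \<sigma>) - ln (?b \<sigma>))" if "\<sigma> \<in> Omega" for \<sigma>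
    using that by (intro diff_mult_ln_diff_ge pmf_ising_pos pmf_le_1)
  then have "(\<Sum>\<sigma>\<in>Omega. (?a \<sigma> - ?b \<sigma>)\<^sup>2) \<le> (\<Sum>\<sigma>\<in>Omega. (?a \<sigma> - ?b \<sigma>) * (ln (?a \<sigma>) - ln (?b \<sigma>)))"
    by (rule sum_mono)
  moreover have "0 \<le> (\<Sum>\<sigma>\<in>Omega. (?a \<sigma> - ?b \<sigma>)\<^sup>2)"
    by (rule sum_nonneg) simp
  ultimately have "(\<Sum>\<sigma>\<in>Omega. (?a \<sigma> - ?b \<sigma>)\<^sup>2) = 0"
    by linarith
  then have eq: "?a \<sigma> = ?b \<sigma>" if "\<sigma> \<in> Omega" for \<sigma>
    using that by (simp add: sum_nonneg_eq_0_iff finite_Omega)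
  then have G: "G \<sigma> = - c" if "\<sigma> \<in> Omega" for \<sigma> using log[OF that] that by simp
  have "h $ l = h' $ l" for l
  proof -
    define \<sigma> where "\<sigma> = ((\<chi> i. 1) :: real ^ 'n)"
    have "\<sigma> \<in> Omega" "set_spin l \<sigma> (-1) \<in> Omega" by (auto simp: \<sigma>_def Omega_def)
    then have "G (set_spin l \<sigma> (-1)) = G \<sigma>" by (simp add: G)
    then show ?thesis by (simp add: G_def linear_set_spin \<sigma>_def del: set_spin_nth)
  qed
  then show ?thesis by (simp add: vec_eq_iff)
qed

end

section \<open>Existence of solutions by Wild's series\<close>

lemma pmf_of_mass_function_ex:
  fixes u :: "real ^ 'n::finite \<Rightarrow> real"
  assumes "mass_function u"
  shows "\<exists>p\<in>Prob. \<forall>\<sigma>\<in>Omega. pmf p \<sigma> = u \<sigma>"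
proof -
  let ?f = "\<lambda>\<sigma>. if \<sigma> \<in> Omega then u \<sigma> else 0"
  have nn: "0 \<le> ?f \<sigma>" for \<sigma> using mass_function_nonneg[OF assms] by simp
  have "(\<integral>\<^sup>+\<sigma>. ennreal (?f \<sigma>) \<partial>count_space UNIV) = (\<Sum>\<sigma>\<in>Omega. ennreal (?f \<sigma>))"
    by (rule nn_integral_count_space'[OF finite_Omega]) auto
  also have "\<dots> = ennreal (\<Sum>\<sigma>\<in>Omega. ?f \<sigma>)" by (rule sum_ennreal) (rule nn)
  also have "(\<Sum>\<sigma>\<in>Omega. ?f \<sigma>) = 1" using assms by (simp add: mass_function_def)
  finally have total: "(\<integral>\<^sup>+\<sigma>. ennreal (?f \<sigma>) \<partial>count_space UNIV) = 1" by simp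
  have pmf: "pmf (embed_pmf ?f) \<sigma> = ?f \<sigma>" for \<sigma> by (rule pmf_embed_pmf[OF nn total])
  then have "set_pmf (embed_pmf ?f) \<subseteq> Omega" by (auto simp: set_pmf_eq)
  then show ?thesis using pmf by (intro bexI[of _ "embed_pmf ?f"]) (auto simp: Prob_def)
qed

lemma kernel_nonneg: "(\<And>l k. 0 \<le> K $ l $ k) \<Longrightarrow> 0 \<le> kernel J K \<sigma> \<sigma>' \<tau> \<tau>'"
  unfolding kernel_def by (intro mult_nonneg_nonneg sum_nonneg site_kernel_nonneg) auto

text \<open>The structure constants of the bilinear product, symmetrised in the two incoming particles.\<close>
definition collide_coeff ::
  "real ^ 'n ^ 'n \<Rightarrow> real ^ 'n ^ 'n \<Rightarrow> real ^ 'n \<Rightarrow> (real ^ 'n) \<times> (real ^ 'n::finite) \<Rightarrow> real" where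
  "collide_coeff J K \<tau> x =
     (\<Sum>\<tau>'\<in>Omega. kernel J K (fst x) (snd x) \<tau> \<tau>' + kernel J K (snd x) (fst x) \<tau> \<tau>') / 2"

lemma collide_bilinear:
  "collide J K u v \<tau> = (\<Sum>x\<in>Omega \<times> Omega. collide_coeff J K \<tau> x * (u (fst x) * v (snd x)))"
proof -
  define k where "k x = (\<Sum>\<tau>'\<in>Omega. kernel J K (fst x) (snd x) \<tau> \<tau>')" for x
  have "collide J K u v \<tau> = 1/2 * (\<Sum>x\<in>Omega \<times> Omega. (u (fst x) * v (snd x) + u (snd x) * v (fst x)) * k x)"
    unfolding collide_def k_def
    by (subst sum.cartesian_product) (simp add: case_prod_beta flip: sum_distrib_left)
  also have "\<dots> = (\<Sum>x\<in>Omega \<times> Omega. u (fst x) * v (snd x) * k x / 2)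
     + (\<Sum>x\<in>Omega \<times> Omega. u (snd x) * v (fst x) * k x / 2)"
    unfolding sum_distrib_left sum.distrib[symmetric] by (intro sum.cong refl) (simp add: algebra_simps)
  also have "(\<Sum>x\<in>Omega \<times> Omega. u (snd x) * v (fst x) * k x / 2)
     = (\<Sum>x\<in>Omega \<times> Omega. u (fst x) * v (snd x) * k (prod.swap x) / 2)"
    by (rule sum.reindex_bij_witness[where i = prod.swap and j = prod.swap]) auto
  also have "(\<Sum>x\<in>Omega \<times> Omega. u (fst x) * v (snd x) * k x / 2)
     + (\<Sum>x\<in>Omega \<times> Omega. u (fst x) * v (snd x) * k (prod.swap x) / 2)
     = (\<Sum>x\<in>Omega \<times> Omega. (k x + k (prod.swap x)) / 2 * (u (fst x) * v (snd x)))"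
    unfolding sum.distrib[symmetric] by (intro sum.cong refl) (simp add: algebra_simps)
  finally show ?thesis by (simp add: collide_coeff_def k_def sum.distrib)
qed

lemma collide_cong:
  "(\<And>\<sigma>. \<sigma> \<in> Omega \<Longrightarrow> u \<sigma> = u' \<sigma>) \<Longrightarrow> (\<And>\<sigma>. \<sigma> \<in> Omega \<Longrightarrow> v \<sigma> = v' \<sigma>)
    \<Longrightarrow> collide J K u v \<tau> = collide J K u' v' \<tau>"
  unfolding collide_bilinear by (intro sum.cong refl) (simp add: mem_Times_iff)

context exchange_dynamics
begin

lemma collide_nonneg:
  assumes "\<And>\<sigma>. \<sigma> \<in> Omega \<Longrightarrow> 0 \<le> u \<sigma>" "\<And>\<sigma>. \<sigma> \<in> Omega \<Longrightarrow> 0 \<le> v \<sigma>"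
  shows "0 \<le> collide J K u v \<tau>"
  unfolding collide_bilinear collide_coeff_def using assms
  by (intro sum_nonneg mult_nonneg_nonneg divide_nonneg_nonneg add_nonneg_nonneg kernel_nonneg K_nonneg)
    (auto simp: mem_Times_iff)

lemma sum_collide: "(\<Sum>\<tau>\<in>Omega. collide J K u v \<tau>) = (\<Sum>\<sigma>\<in>Omega. u \<sigma>) * (\<Sum>\<sigma>\<in>Omega. v \<sigma>)"
proof -
  have "(\<Sum>x\<in>Omega \<times> Omega. f (fst x) * g (snd x)) = (\<Sum>\<sigma>\<in>Omega. f \<sigma>) * (\<Sum>\<sigma>\<in>Omega. g \<sigma>)"
    for f g :: "real ^ 'n \<Rightarrow> real"
    by (simp add: sum_product sum.cartesian_product case_prod_beta)
  from this[of u v] this[of v u]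
  have "(\<Sum>x\<in>Omega \<times> Omega. u (fst x) * v (snd x) + u (snd x) * v (fst x))
      = 2 * ((\<Sum>\<sigma>\<in>Omega. u \<sigma>) * (\<Sum>\<sigma>\<in>Omega. v \<sigma>))"
    by (simp add: sum.distrib mult.commute)
  then show ?thesis
    using collide_weak[of J K u v "\<lambda>_. 1"] by (simp add: K_row_sum flip: sum_distrib_right)
qed

lemma mass_function_collide: "mass_function u \<Longrightarrow> mass_function v \<Longrightarrow> mass_function (collide J K u v)"
  by (simp add: mass_function_def sum_collide collide_nonneg)

text \<open>The Taylor coefficients of the solution of \<open>U' = U \<circ> U\<close>, \<open>U 0 = p\<close>. If \<open>p\<close> is a mass function, so is every
  one of them, being an average of \<open>n + 1\<close> collision products; this yields convergence for
  \<open>\<bar>s\<bar> < 1\<close>.\<close>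
fun wild :: "(real ^ 'n \<Rightarrow> real) \<Rightarrow> nat \<Rightarrow> real ^ 'n \<Rightarrow> real" where
  "wild p 0 = p"
| "wild p (Suc n) = (\<lambda>\<tau>. (\<Sum>k\<le>n. collide J K (wild p k) (wild p (n - k)) \<tau>) / real (Suc n))"

lemma mass_function_wild: "mass_function p \<Longrightarrow> mass_function (wild p n)"
proof (induction n rule: less_induct)
  case (less n)
  show ?case
  proof (cases n)
    case (Suc m)
    have d: "mass_function (collide J K (wild p k) (wild p (m - k)))" if "k \<le> m" for k
      using that less Suc by (intro mass_function_collide) auto
    have "(\<Sum>\<tau>\<in>Omega. \<Sum>k\<le>m. collide J K (wild p k) (wild p (m - k)) \<tau>) = (\<Sum>k\<le>m. 1)"
      by (subst sum.swap) (use d in \<open>auto simp: mass_function_def intro!: sum.cong\<close>)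
    then show ?thesis
      unfolding Suc mass_function_def using d[unfolded mass_function_def]
      by (auto intro!: divide_nonneg_nonneg sum_nonneg simp flip: sum_divide_distrib)
  qed (use less in simp)
qed

definition wild_series :: "(real ^ 'n \<Rightarrow> real) \<Rightarrow> real \<Rightarrow> real ^ 'n \<Rightarrow> real" where
  "wild_series p s \<tau> = (\<Sum>n. wild p n \<tau> * s ^ n)"

lemma summable_wild:
  assumes p: "mass_function p" and \<tau>: "\<tau> \<in> Omega" and s: "\<bar>s\<bar> < 1"
  shows "summable (\<lambda>n. norm (wild p n \<tau> * s ^ n))"
proof (rule summable_comparison_test')
  show "summable (\<lambda>n. \<bar>s\<bar> ^ n)" using s by (simp add: summable_geometric)
  show "norm (norm (wild p n \<tau> * s ^ n)) \<le> \<bar>s\<bar> ^ n" for n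
    using mass_function_nonneg[OF mass_function_wild[OF p] \<tau>] mass_function_le_1[OF mass_function_wild[OF p] \<tau>]
    by (simp add: abs_mult power_abs mult_left_le_one_le)
qed

text \<open>The recursion for the coefficients says that the differentiated series is the Cauchy product
  of the series with itself under \<^const>\<open>collide\<close>.\<close>
lemma wild_series_deriv:
  assumes p: "mass_function p" and \<tau>: "\<tau> \<in> Omega" and s: "\<bar>s\<bar> < 1"
  shows "((\<lambda>s. wild_series p s \<tau>) has_real_derivative collide J K (wild_series p s) (wild_series p s) \<tau>) (at s)"
proof -
  let ?c = "\<lambda>n. wild p n \<tau>"
  have "(\<lambda>n. collide_coeff J K \<tau> x * (\<Sum>k\<le>n. wild p k (fst x) * s ^ k * (wild p (n - k) (snd x) * s ^ (n - k))))
     sums (collide_coeff J K \<tau> x * (wild_series p s (fst x) * wild_series p s (snd x)))"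
    if "x \<in> Omega \<times> Omega" for x
    unfolding wild_series_def
    using that s by (intro sums_mult Cauchy_product_sums summable_wild p) (auto simp: mem_Times_iff)
  then have "(\<lambda>n. \<Sum>x\<in>Omega \<times> Omega. collide_coeff J K \<tau> x *
       (\<Sum>k\<le>n. wild p k (fst x) * s ^ k * (wild p (n - k) (snd x) * s ^ (n - k))))
     sums collide J K (wild_series p s) (wild_series p s) \<tau>"
    unfolding collide_bilinear by (rule sums_sum)
  moreover have "(\<Sum>x\<in>Omega \<times> Omega. collide_coeff J K \<tau> x *
       (\<Sum>k\<le>n. wild p k (fst x) * s ^ k * (wild p (n - k) (snd x) * s ^ (n - k))))
     = diffs ?c n * s ^ n" for n
  proof -
    have "s ^ k * s ^ (n - k) = s ^ n" if "k \<le> n" for k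
      using that by (simp flip: power_add)
    then have "(\<Sum>k\<le>n. wild p k a * s ^ k * (wild p (n - k) b * s ^ (n - k)))
        = (\<Sum>k\<le>n. wild p k a * wild p (n - k) b) * s ^ n" for a b
      unfolding sum_distrib_right by (intro sum.cong refl) (simp add: mult_ac)
    then have "(\<Sum>x\<in>Omega \<times> Omega. collide_coeff J K \<tau> x *
       (\<Sum>k\<le>n. wild p k (fst x) * s ^ k * (wild p (n - k) (snd x) * s ^ (n - k))))
      = (\<Sum>x\<in>Omega \<times> Omega. \<Sum>k\<le>n. collide_coeff J K \<tau> x * (wild p k (fst x) * wild p (n - k) (snd x))) * s ^ n"
      by (simp add: sum_distrib_left sum_distrib_right mult_ac)
    also have "(\<Sum>x\<in>Omega \<times> Omega. \<Sum>k\<le>n. collide_coeff J K \<tau> x * (wild p k (fst x) * wild p (n - k) (snd x)))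
      = (\<Sum>k\<le>n. collide J K (wild p k) (wild p (n - k)) \<tau>)"
      unfolding collide_bilinear by (rule sum.swap)
    also have "\<dots> = diffs ?c n" by (simp add: diffs_def)
    finally show ?thesis .
  qed
  ultimately have "(\<lambda>n. diffs ?c n * s ^ n) sums collide J K (wild_series p s) (wild_series p s) \<tau>"
    by simp
  then have "(\<Sum>n. diffs ?c n * s ^ n) = collide J K (wild_series p s) (wild_series p s) \<tau>"
    by (simp add: sums_iff)
  moreover have "((\<lambda>s. \<Sum>n. ?c n * s ^ n) has_real_derivative (\<Sum>n. diffs ?c n * s ^ n)) (at s)"
    using s by (intro termdiffs_strong'[of 1] summable_norm_cancel[OF summable_wild] p \<tau>) auto
  ultimately show ?thesis by (simp add: wild_series_def)
qed

lemma sum_wild_series: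
  assumes p: "mass_function p" and s: "\<bar>s\<bar> < 1"
  shows "(\<Sum>\<tau>\<in>Omega. wild_series p s \<tau>) = 1 / (1 - s)"
proof -
  have "(\<lambda>n. \<Sum>\<tau>\<in>Omega. wild p n \<tau> * s ^ n) sums (\<Sum>\<tau>\<in>Omega. wild_series p s \<tau>)"
    unfolding wild_series_def
    by (intro sums_sum summable_sums summable_norm_cancel[OF summable_wild] p s)
  moreover have "(\<Sum>\<tau>\<in>Omega. wild p n \<tau> * s ^ n) = s ^ n" for n
    using mass_function_wild[OF p, of n] by (simp add: mass_function_def flip: sum_distrib_right)
  ultimately show ?thesis using geometric_sums[of s] s by (simp add: sums_iff)
qed

text \<open>Substituting \<open>p\<^sub>t = e\<^sup>-\<^sup>t U (1 - e\<^sup>-\<^sup>t)\<close> into \<open>U' = U \<circ> U\<close> produces the loss term \<open>- p\<^sub>t\<close>, and maps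
  all times \<open>t \<ge> 0\<close> to arguments in \<open>[0, 1)\<close>. The total mass is \<open>e\<^sup>-\<^sup>t / (1 - (1 - e\<^sup>-\<^sup>t)) = 1\<close>.\<close>
lemma solution_ex:
  assumes p: "p \<in> Prob"
  shows "\<exists>P. solves_nonlinear J K p P"
proof -
  have dp: "mass_function (pmf p)" by (rule mass_function_pmf[OF p])
  define U where "U = wild_series (pmf p)"
  define f where "f t \<tau> = exp (- t) * U (1 - exp (- t)) \<tau>" for t :: real and \<tau>
  have small: "\<bar>1 - exp (- t)\<bar> < 1" if "0 \<le> t" for t :: real using that by simp
  have dens: "mass_function (f t)" if t: "0 \<le> t" for t
  proof -
    have "0 \<le> U (1 - exp (- t)) \<tau>" if "\<tau> \<in> Omega" for \<tau>
      unfolding U_def wild_series_def using t that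
      by (intro suminf_nonneg summable_norm_cancel[OF summable_wild] dp mult_nonneg_nonneg
            mass_function_nonneg[OF mass_function_wild]) auto
    moreover have "(\<Sum>\<tau>\<in>Omega. f t \<tau>) = 1"
      using sum_wild_series[OF dp small[OF t]] by (simp add: f_def U_def flip: sum_distrib_left)
    ultimately show ?thesis by (simp add: mass_function_def f_def)
  qed
  have deriv: "((\<lambda>t. f t \<tau>) has_real_derivative collide J K (f t) (f t) \<tau> - f t \<tau>) (at t)"
    if "0 \<le> t" "\<tau> \<in> Omega" for t \<tau>
  proof -
    let ?s = "1 - exp (- t)"
    have "((\<lambda>t. U (1 - exp (- t)) \<tau>) has_real_derivative collide J K (U ?s) (U ?s) \<tau> * exp (- t)) (at t)"
      unfolding U_def
      by (rule DERIV_chain2[where f = "\<lambda>s. wild_series (pmf p) s \<tau>" and g = "\<lambda>t. 1 - exp (- t)",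
            OF wild_series_deriv[OF dp that(2) small[OF that(1)]]])
        (auto intro!: derivative_eq_intros)
    then have "((\<lambda>t. f t \<tau>) has_real_derivative
        (exp (- t) * (collide J K (U ?s) (U ?s) \<tau> * exp (- t)) + - exp (- t) * U ?s \<tau>)) (at t)"
      unfolding f_def by (auto intro!: derivative_eq_intros)
    moreover have "collide J K (f t) (f t) \<tau> = exp (- t) * (collide J K (U ?s) (U ?s) \<tau> * exp (- t))"
      by (simp add: collide_bilinear f_def sum_distrib_left sum_distrib_right mult_ac)
    ultimately show ?thesis by (simp add: f_def)
  qed
  have "\<forall>t\<in>{0..}. \<exists>q. q \<in> Prob \<and> (\<forall>\<sigma>\<in>Omega. pmf q \<sigma> = f t \<sigma>)"
    using pmf_of_mass_function_ex[OF dens] by auto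
  then obtain P where P: "\<And>t. 0 \<le> t \<Longrightarrow> P t \<in> Prob"
    and pmf_P: "\<And>t \<sigma>. 0 \<le> t \<Longrightarrow> \<sigma> \<in> Omega \<Longrightarrow> pmf (P t) \<sigma> = f t \<sigma>"
    by (metis atLeast_iff)
  have "P 0 = p"
    using P p by (intro pmf_eq_on_Omega) (simp_all add: pmf_P f_def U_def wild_series_def)
  moreover have "((\<lambda>s. pmf (P s) \<tau>) has_real_derivative collide J K (pmf (P t)) (pmf (P t)) \<tau> - pmf (P t) \<tau>)
      (at t within {0..})" if "0 \<le> t" "\<tau> \<in> Omega" for t \<tau>
  proof -
    have "collide J K (pmf (P t)) (pmf (P t)) \<tau> = collide J K (f t) (f t) \<tau>"
      using that(1) by (intro collide_cong pmf_P)
    then have "((\<lambda>t. f t \<tau>) has_real_derivative collide J K (pmf (P t)) (pmf (P t)) \<tau> - pmf (P t) \<tau>)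
        (at t within {0..})"
      using deriv[OF that] that by (simp add: pmf_P has_field_derivative_at_within)
    then show ?thesis
      by (rule has_field_derivative_transform_within[where d = 1]) (use that in \<open>auto simp: pmf_P\<close>)
  qed
  ultimately show ?thesis
    using P unfolding solves_nonlinear_def collision_eq_collide by blast
qed

end

section \<open>Long-time behaviour of solutions\<close>

lemma decreasing_of_deriv_within:
  fixes f f' :: "real \<Rightarrow> real"
  assumes deriv: "\<And>t. a \<le> t \<Longrightarrow> (f has_real_derivative f' t) (at t within {a..})"
    and le: "\<And>t. a \<le> t \<Longrightarrow> f' t \<le> 0" and "a \<le> s" "s \<le> t"
  shows "f t \<le> f s"
proof (rule DERIV_nonpos_imp_decreasing_open[OF \<open>s \<le> t\<close>])
  fix x assume "s < x" "x < t"
  then have "a < x" "a \<le> x" using \<open>a \<le> s\<close> by auto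
  then have "(f has_real_derivative f' x) (at x)"
    using deriv[of x] at_within_interior[of x "{a..}"] by (simp add: interior_real_atLeast)
  then show "\<exists>y. (f has_real_derivative y) (at x) \<and> y \<le> 0" using le[OF \<open>a \<le> x\<close>] by blast
next
  have "continuous_on {a..} f" using deriv by (intro DERIV_continuous_on) auto
  then show "continuous_on {s..t} f" by (rule continuous_on_subset) (use \<open>a \<le> s\<close> in auto)
qed

lemma finite_pointwise_convergent_subsequence:
  fixes f :: "nat \<Rightarrow> 'a \<Rightarrow> real"
  assumes "finite S" and bounds: "\<And>k x. x \<in> S \<Longrightarrow> 0 \<le> f k x \<and> f k x \<le> 1"
  shows "\<exists>l r. strict_mono (r :: nat \<Rightarrow> nat) \<and> (\<forall>x\<in>S. (\<lambda>k. f (r k) x) \<longlonglongrightarrow> l x)"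
proof -
  have "bounded ((\<lambda>g. g x) ` range f)" if "x \<in> S" for x
    by (rule boundedI[of _ 1]) (use bounds[OF that] in auto)
  then have "\<forall>\<delta>\<subseteq>S. \<exists>l r. strict_mono (r :: nat \<Rightarrow> nat) \<and>
      (\<forall>e>0. \<forall>\<^sub>F n in sequentially. \<forall>x\<in>\<delta>. dist (f (r n) x) (l x) < e)"
    using \<open>finite S\<close>
    by (intro compact_lemma_general[where proj = "\<lambda>g x. g x" and unproj = "\<lambda>g. g"]) auto
  then obtain l r where r: "strict_mono (r :: nat \<Rightarrow> nat)"
    and close: "\<And>e. 0 < e \<Longrightarrow> \<forall>\<^sub>F n in sequentially. \<forall>x\<in>S. dist (f (r n) x) (l x) < e"
    by blast
  have "(\<lambda>k. f (r k) x) \<longlonglongrightarrow> l x" if "x \<in> S" for x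
  proof (intro tendstoI)
    fix e :: real assume "0 < e"
    then have "\<forall>\<^sub>F n in sequentially. \<forall>x\<in>S. dist (f (r n) x) (l x) < e" by (rule close)
    then show "\<forall>\<^sub>F n in sequentially. dist (f (r n) x) (l x) < e"
      by (rule eventually_mono) (use that in blast)
  qed
  with r show ?thesis by blast
qed

lemma tv_dist_le_l1:
  fixes p q :: "(real ^ 'n::finite) pmf"
  assumes "p \<in> Prob" "q \<in> Prob"
  shows "0 \<le> tv_dist p q \<and> tv_dist p q \<le> (\<Sum>\<sigma>\<in>Omega. \<bar>pmf p \<sigma> - pmf q \<sigma>\<bar>)"
proof -
  let ?d = "\<lambda>E. \<bar>measure_pmf.prob p E - measure_pmf.prob q E\<bar>"
  have prob: "measure_pmf.prob r E = (\<Sum>\<sigma>\<in>E \<inter> Omega. pmf r \<sigma>)" if "r \<in> Prob" for r and E :: "(real ^ 'n) set"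
  proof -
    have "measure_pmf.prob r E = measure_pmf.prob r (E \<inter> Omega)"
      using that by (intro measure_pmf.finite_measure_eq_AE) (auto simp: AE_measure_pmf_iff Prob_def)
    also have "\<dots> = (\<Sum>\<sigma>\<in>E \<inter> Omega. pmf r \<sigma>)"
      by (rule measure_measure_pmf_finite) (simp add: finite_Omega)
    finally show ?thesis .
  qed
  have le: "?d E \<le> (\<Sum>\<sigma>\<in>Omega. \<bar>pmf p \<sigma> - pmf q \<sigma>\<bar>)" for E
  proof -
    have "?d E = \<bar>\<Sum>\<sigma>\<in>E \<inter> Omega. pmf p \<sigma> - pmf q \<sigma>\<bar>"
      using assms by (simp add: prob sum_subtractf)
    also have "\<dots> \<le> (\<Sum>\<sigma>\<in>E \<inter> Omega. \<bar>pmf p \<sigma> - pmf q \<sigma>\<bar>)" by (rule sum_abs)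
    also have "\<dots> \<le> (\<Sum>\<sigma>\<in>Omega. \<bar>pmf p \<sigma> - pmf q \<sigma>\<bar>)" by (rule sum_mono2) (auto simp: finite_Omega)
    finally show ?thesis .
  qed
  have "?d {} \<le> tv_dist p q" unfolding tv_dist_def
    by (rule cSUP_upper[OF UNIV_I bdd_aboveI2[OF le]])
  moreover have "tv_dist p q \<le> (\<Sum>\<sigma>\<in>Omega. \<bar>pmf p \<sigma> - pmf q \<sigma>\<bar>)"
    unfolding tv_dist_def by (rule cSUP_least) (use le in auto)
  ultimately show ?thesis by simp
qed

context exchange_dynamics
begin

text \<open>At a stationary state with full support the entropy production is zero, hence so is the
  dissipation.\<close>
lemma stationary_iff_ising:
  assumes p: "p \<in> Prob" and mean: "\<And>A. A \<in> blocks \<Longrightarrow> \<bar>mean_spin (pmf p) A\<bar> \<noteq> 1"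
  shows "stationary J K p \<longleftrightarrow> (\<exists>h\<in>Gamma_part blocks. p = ising J h)"
proof
  have d: "mass_function (pmf p)" by (rule mass_function_pmf[OF p])
  assume stat: "stationary J K p"
  then have fix_eq: "collide J K (pmf p) (pmf p) \<tau> = pmf p \<tau>" if "\<tau> \<in> Omega" for \<tau>
    using that by (simp add: stationary_def collision_eq_collide)
  then have "pair_mass (pmf p) (exchange l k x) \<noteq> 0"
    if "0 < K $ l $ k" "x \<in> Omega \<times> Omega" "pair_mass (pmf p) x \<noteq> 0" for l k x
    using support_closed_under_exchange[OF d _ that] by simp
  then have pos: "0 < pmf p \<sigma>" if "\<sigma> \<in> Omega" for \<sigma>
    using full_support[OF d _ mean that] by blast
  have "(0 :: real ^ 'n) \<in> Gamma_part blocks" by (simp add: Gamma_part_def)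
  then have "0 \<le> - dissipation (pmf p) / (4 * real CARD('n))"
    using entropy_production[OF d pos, of 0] by (simp add: fix_eq)
  then have "dissipation (pmf p) = 0"
    using dissipation_nonneg[of "pmf p"] by (simp add: divide_le_0_iff)
  then obtain h where "h \<in> Gamma_part blocks" "\<forall>\<sigma>\<in>Omega. pmf p \<sigma> = pmf (ising J h) \<sigma>"
    using balanced_positive_is_ising[OF d pos] dissipation_eq_0_iff by blast
  then show "\<exists>h\<in>Gamma_part blocks. p = ising J h"
    using pmf_eq_on_Omega[OF p ising_in_Prob] by blast
next
  assume "\<exists>h\<in>Gamma_part blocks. p = ising J h"
  then show "stationary J K p"
    using balanced_collide[OF mass_function_ising balanced_ising]
    by (auto simp: stationary_def collision_eq_collide)
qed

end

locale exchange_solution = exchange_dynamics J K for J K :: "real ^ 'n ^ 'n::finite" +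
  fixes p :: "(real ^ 'n) pmf" and P :: "real \<Rightarrow> (real ^ 'n) pmf"
  assumes p_Prob: "p \<in> Prob" and sol: "solves_nonlinear J K p P"
begin

abbreviation "u t \<equiv> pmf (P t)"

lemma u_0: "u 0 = pmf p"
  using sol by (simp add: solves_nonlinear_def)

lemma P_Prob: "0 \<le> t \<Longrightarrow> P t \<in> Prob"
  using sol by (simp add: solves_nonlinear_def)

lemma mass_function_u: "0 \<le> t \<Longrightarrow> mass_function (u t)"
  by (rule mass_function_pmf[OF P_Prob])

lemma u_deriv: "0 \<le> t \<Longrightarrow> \<tau> \<in> Omega \<Longrightarrow>
    ((\<lambda>s. u s \<tau>) has_real_derivative collide J K (u t) (u t) \<tau> - u t \<tau>) (at t within {0..})"
  using sol by (simp add: solves_nonlinear_def collision_eq_collide)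

lemma linear_constant:
  assumes g: "\<And>l k. 0 < K $ l $ k \<Longrightarrow> g l = g k" and t: "0 \<le> t"
  shows "(\<Sum>\<tau>\<in>Omega. u t \<tau> * (\<Sum>i\<in>UNIV. g i * \<tau> $ i)) = (\<Sum>\<tau>\<in>Omega. pmf p \<tau> * (\<Sum>i\<in>UNIV. g i * \<tau> $ i))"
proof -
  let ?F = "\<lambda>t. \<Sum>\<tau>\<in>Omega. u t \<tau> * (\<Sum>i\<in>UNIV. g i * \<tau> $ i)"
  have "(?F has_real_derivative 0) (at s within {0..})" if "s \<in> {0..}" for s
  proof -
    have "(?F has_real_derivative (\<Sum>\<tau>\<in>Omega. (collide J K (u s) (u s) \<tau> - u s \<tau>) * (\<Sum>i\<in>UNIV. g i * \<tau> $ i)))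
        (at s within {0..})"
      using that by (intro DERIV_sum DERIV_cmult_right u_deriv) auto
    then show ?thesis using linear_conserved[OF mass_function_u g] that by simp
  qed
  then have "\<exists>c. \<forall>s\<in>{0..}. ?F s = c"
    by (intro has_field_derivative_zero_constant) auto
  then have "?F t = ?F 0" using t by auto
  then show ?thesis by (simp add: u_0)
qed

lemma mean_spin_constant: "A \<in> blocks \<Longrightarrow> 0 \<le> t \<Longrightarrow> mean_spin (u t) A = mean_spin (pmf p) A"
  unfolding mean_spin_def using linear_constant[of "\<lambda>i. of_bool (i \<in> A)" t] block_edge[of A] by simp

text \<open>\<open>e\<^sup>t p\<^sub>t\<close> is nondecreasing, its derivative \<open>e\<^sup>t (p\<^sub>t \<circ> p\<^sub>t)\<close> being nonnegative.\<close>
lemma positivity_persists: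
  assumes "0 \<le> s" "s \<le> t" and \<tau>: "\<tau> \<in> Omega" and pos: "0 < u s \<tau>"
  shows "0 < u t \<tau>"
proof -
  have "- (exp t * u t \<tau>) \<le> - (exp s * u s \<tau>)"
  proof (rule decreasing_of_deriv_within[OF _ _ assms(1,2)])
    fix r :: real assume r: "0 \<le> r"
    show "((\<lambda>r. - (exp r * u r \<tau>)) has_real_derivative - (exp r * collide J K (u r) (u r) \<tau>)) (at r within {0..})"
      by (rule derivative_eq_intros u_deriv[OF r \<tau>] refl)+ (simp add: algebra_simps)
    show "- (exp r * collide J K (u r) (u r) \<tau>) \<le> 0"
      using collide_nonneg[of "u r" "u r" \<tau>] by simp
  qed
  then have "0 < exp t * u t \<tau>" using pos by (smt (verit) exp_gt_zero mult_pos_pos)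
  then show ?thesis by (simp add: zero_less_mult_iff)
qed

text \<open>By persistence the support grows, and at some finite time \<open>T\<close> it has reached its final value
  \<open>S\<close>. Outside \<open>S\<close> the solution is constantly zero, so its derivative and hence \<open>p\<^sub>T \<circ> p\<^sub>T\<close> vanish
  there; that makes \<open>S\<close> closed under exchanges.\<close>
lemma eventually_full_support:
  assumes mean: "\<And>A. A \<in> blocks \<Longrightarrow> \<bar>mean_spin (pmf p) A\<bar> \<noteq> 1"
  shows "\<exists>T\<ge>0. \<forall>t\<ge>T. \<forall>\<tau>\<in>Omega. 0 < u t \<tau>"
proof -
  define S where "S = {\<tau> \<in> Omega. \<exists>t\<ge>0. 0 < u t \<tau>}"
  then have "\<forall>\<tau>\<in>S. \<exists>t\<ge>0. 0 < u t \<tau>" by blast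
  then obtain r where r: "\<And>\<tau>. \<tau> \<in> S \<Longrightarrow> 0 \<le> r \<tau> \<and> 0 < u (r \<tau>) \<tau>" by metis
  \<comment> \<open>Including \<open>1\<close> keeps \<open>T\<close> away from \<open>0\<close>, where only a one-sided derivative is available.\<close>
  define T where "T = Max (insert 1 (r ` S))"
  have fin: "finite S" by (rule finite_subset[OF _ finite_Omega]) (auto simp: S_def)
  have T1: "1 \<le> T" unfolding T_def using fin by (intro Max_ge) auto
  have "r \<tau> \<le> T" if "\<tau> \<in> S" for \<tau> unfolding T_def using fin that by (intro Max_ge) auto
  then have pos_S: "0 < u T \<tau>" if "\<tau> \<in> S" for \<tau>
    using positivity_persists[of "r \<tau>" T \<tau>] r[OF that] that by (auto simp: S_def)
  have "collide J K (u T) (u T) \<tau> = 0" if \<tau>: "\<tau> \<in> Omega" and "u T \<tau> = 0" for \<tau>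
  proof -
    have "\<tau> \<notin> S" using pos_S[of \<tau>] \<open>u T \<tau> = 0\<close> by auto
    then have null: "u t \<tau> = 0" if "0 \<le> t" for t
    proof -
      have "\<not> 0 < u t \<tau>" using \<open>\<tau> \<notin> S\<close> that \<tau> unfolding S_def by blast
      then show ?thesis using mass_function_nonneg[OF mass_function_u[OF that] \<tau>] by linarith
    qed
    have "((\<lambda>s. u s \<tau>) has_real_derivative collide J K (u T) (u T) \<tau> - u T \<tau>) (at T)"
      using u_deriv[OF _ \<tau>, of T] T1 at_within_interior[of T "{0..}"] by (simp add: interior_real_atLeast)
    then have "collide J K (u T) (u T) \<tau> - u T \<tau> = 0"
      by (rule DERIV_local_const[of _ _ _ 1]) (use T1 null in auto)
    then show ?thesis using \<open>u T \<tau> = 0\<close> by simp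
  qed
  then have "pair_mass (u T) (exchange l k x) \<noteq> 0"
    if "0 < K $ l $ k" "x \<in> Omega \<times> Omega" "pair_mass (u T) x \<noteq> 0" for l k x
    using support_closed_under_exchange[OF mass_function_u _ that] T1 by simp
  moreover have "\<bar>mean_spin (u T) A\<bar> \<noteq> 1" if "A \<in> blocks" for A
    using mean[OF that] mean_spin_constant[OF that] T1 by simp
  ultimately have "0 < u T \<tau>" if "\<tau> \<in> Omega" for \<tau>
    using full_support[OF mass_function_u _ _ that, of T] T1 by auto
  then have "\<forall>t\<ge>T. \<forall>\<tau>\<in>Omega. 0 < u t \<tau>"
    using positivity_persists[of T] T1 by auto
  then show ?thesis using T1 by (intro exI[of _ T]) auto
qed

lemma entropy_deriv:
  assumes "0 \<le> T" "T \<le> t" and pos: "\<And>\<tau>. \<tau> \<in> Omega \<Longrightarrow> 0 < u t \<tau>" and h: "h \<in> Gamma_part blocks"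
  shows "\<exists>D \<le> - dissipation (u t) / (4 * real CARD('n)).
    ((\<lambda>s. rel_entropy (u s) (pmf (ising J h))) has_real_derivative D) (at t within {T..})"
proof (intro exI conjI)
  let ?v = "\<lambda>\<tau>. collide J K (u t) (u t) \<tau> - u t \<tau>"
  let ?\<phi> = "\<lambda>\<tau>. ln (u t \<tau>) - ln (pmf (ising J h) \<tau>)"
  have t: "0 \<le> t" using assms by simp
  have "((\<lambda>s. u s \<tau> * (ln (u s \<tau>) - ln (pmf (ising J h) \<tau>))) has_real_derivative ?v \<tau> * ?\<phi> \<tau> + ?v \<tau>)
      (at t within {T..})" if \<tau>: "\<tau> \<in> Omega" for \<tau>
  proof -
    have "((\<lambda>s. u s \<tau>) has_real_derivative ?v \<tau>) (at t within {T..})"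
      by (rule DERIV_subset[OF u_deriv[OF t \<tau>]]) (use assms in auto)
    then show ?thesis using pos[OF \<tau>]
      by (auto intro!: derivative_eq_intros simp: field_simps)
  qed
  then have "((\<lambda>s. rel_entropy (u s) (pmf (ising J h))) has_real_derivative (\<Sum>\<tau>\<in>Omega. ?v \<tau> * ?\<phi> \<tau> + ?v \<tau>))
      (at t within {T..})"
    unfolding rel_entropy_def by (intro DERIV_sum)
  moreover have "(\<Sum>\<tau>\<in>Omega. ?v \<tau>) = 0"
    using mass_function_u[OF t] by (simp add: sum_subtractf sum_collide mass_function_def)
  ultimately show "((\<lambda>s. rel_entropy (u s) (pmf (ising J h))) has_real_derivative (\<Sum>\<tau>\<in>Omega. ?v \<tau> * ?\<phi> \<tau>))
      (at t within {T..})"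
    by (simp add: sum.distrib)
  show "(\<Sum>\<tau>\<in>Omega. ?v \<tau> * ?\<phi> \<tau>) \<le> - dissipation (u t) / (4 * real CARD('n))"
    by (rule entropy_production[OF mass_function_u[OF t] pos h])
qed

text \<open>The two uses are \<open>e = 0\<close> (monotonicity) and \<open>e > 0\<close> (a dissipation bounded below would drive
  the entropy to \<open>- \<infinity>\<close>).\<close>
lemma entropy_decay:
  assumes T: "0 \<le> T" and pos: "\<And>t \<tau>. T \<le> t \<Longrightarrow> \<tau> \<in> Omega \<Longrightarrow> 0 < u t \<tau>" and h: "h \<in> Gamma_part blocks"
    and diss: "\<And>t. T \<le> t \<Longrightarrow> e \<le> dissipation (u t)" and "T \<le> s" "s \<le> t"
  shows "rel_entropy (u t) (pmf (ising J h)) + e / (4 * real CARD('n)) * t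
    \<le> rel_entropy (u s) (pmf (ising J h)) + e / (4 * real CARD('n)) * s"
proof -
  let ?H = "\<lambda>t. rel_entropy (u t) (pmf (ising J h))" and ?c = "e / (4 * real CARD('n))"
  have "\<exists>D. (?H has_real_derivative D) (at t within {T..}) \<and> D \<le> - ?c" if "T \<le> t" for t
  proof -
    have "- dissipation (u t) / (4 * real CARD('n)) \<le> - ?c"
      using diss[OF that] by (simp add: divide_right_mono)
    then show ?thesis using entropy_deriv[OF T that pos[OF that] h] by (meson order_trans)
  qed
  then obtain D where D: "\<And>t. T \<le> t \<Longrightarrow> (?H has_real_derivative D t) (at t within {T..})"
    and D_le: "\<And>t. T \<le> t \<Longrightarrow> D t \<le> - ?c" by metis
  show ?thesis
  proof (rule decreasing_of_deriv_within[where f = "\<lambda>t. ?H t + ?c * t", OF _ _ \<open>T \<le> s\<close> \<open>s \<le> t\<close>])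
    fix t assume "T \<le> t"
    then show "((\<lambda>t. ?H t + ?c * t) has_real_derivative D t + ?c) (at t within {T..})"
      by (auto intro!: derivative_eq_intros D)
    show "D t + ?c \<le> 0" using D_le[OF \<open>T \<le> t\<close>] by simp
  qed
qed

lemma rel_entropy_ising_nonneg:
  "0 \<le> t \<Longrightarrow> 0 \<le> rel_entropy (u t) (pmf (ising J h))"
  by (rule order_trans[OF sum_nonneg rel_entropy_ge_hellinger[OF mass_function_u mass_function_ising]])
    (auto intro: pmf_ising_pos)

lemma small_dissipation:
  assumes T: "0 \<le> T" and pos: "\<And>t \<tau>. T \<le> t \<Longrightarrow> \<tau> \<in> Omega \<Longrightarrow> 0 < u t \<tau>" and e: "0 < e"
  shows "\<exists>t\<ge>T. dissipation (u t) < e"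
proof (rule ccontr)
  assume "\<not> ?thesis"
  then have diss: "e \<le> dissipation (u t)" if "T \<le> t" for t using that by force
  let ?H = "\<lambda>t. rel_entropy (u t) (pmf (ising J 0))" and ?c = "e / (4 * real CARD('n))"
  have c: "0 < ?c" using e by simp
  \<comment> \<open>At this time the entropy would have dropped to at most \<open>- 1\<close>.\<close>
  define t where "t = T + (?H T + 1) / ?c"
  have HT: "0 \<le> ?H T" by (rule rel_entropy_ising_nonneg[OF T])
  then have "0 \<le> (?H T + 1) / ?c" using c by (intro divide_nonneg_pos) auto
  then have "T \<le> t" unfolding t_def by linarith
  have "(0 :: real ^ 'n) \<in> Gamma_part blocks" by (simp add: Gamma_part_def)
  then have "?H t + ?c * t \<le> ?H T + ?c * T"
    by (intro entropy_decay[where T = T]) (simp_all add: T pos diss \<open>T \<le> t\<close>)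
  moreover have "?c * t = ?c * T + ?H T + 1"
    using c unfolding t_def distrib_left[of ?c T] times_divide_eq_right
    by (subst nonzero_mult_div_cancel_left) auto
  moreover have "0 \<le> ?H t" using rel_entropy_ising_nonneg T \<open>T \<le> t\<close> by simp
  ultimately show False by linarith
qed

text \<open>Along times at which the dissipation tends to zero, compactness of the simplex gives a limit
  point; it is balanced because the dissipation is continuous, and nondegenerate because mean
  spins are conserved.\<close>
lemma ising_limit_point:
  assumes mean: "\<And>A. A \<in> blocks \<Longrightarrow> \<bar>mean_spin (pmf p) A\<bar> \<noteq> 1"
    and T: "0 \<le> T" and pos: "\<And>t \<tau>. T \<le> t \<Longrightarrow> \<tau> \<in> Omega \<Longrightarrow> 0 < u t \<tau>"
  shows "\<exists>h\<in>Gamma_part blocks. (\<forall>A\<in>blocks. mean_spin (pmf (ising J h)) A = mean_spin (pmf p) A) \<and>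
    (\<exists>s::nat \<Rightarrow> real. (\<forall>k. T \<le> s k) \<and> (\<forall>\<sigma>\<in>Omega. (\<lambda>k. u (s k) \<sigma>) \<longlonglongrightarrow> pmf (ising J h) \<sigma>))"
proof -
  have "\<exists>t\<ge>T. dissipation (u t) < 1 / real (Suc k)" for k
    by (rule small_dissipation[OF T pos]) auto
  then obtain s where s: "\<And>k. T \<le> s k" and diss: "\<And>k. dissipation (u (s k)) < 1 / real (Suc k)"
    by metis
  have s0: "0 \<le> s k" for k using s[of k] T by linarith
  obtain v r where r: "strict_mono (r :: nat \<Rightarrow> nat)" and v: "\<forall>\<sigma>\<in>Omega. (\<lambda>k. u (s (r k)) \<sigma>) \<longlonglongrightarrow> v \<sigma>"
    using finite_pointwise_convergent_subsequence[OF finite_Omega, of "\<lambda>k. u (s k)"] by (auto simp: pmf_le_1)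
  have lim: "(\<lambda>k. u (s (r k)) \<sigma>) \<longlonglongrightarrow> v \<sigma>" if "\<sigma> \<in> Omega" for \<sigma> using v that by blast
  have "mass_function v"
    unfolding mass_function_def
  proof
    show "\<forall>\<sigma>\<in>Omega. 0 \<le> v \<sigma>" using LIMSEQ_le_const[OF lim, of _ 0] by simp
    have "(\<lambda>k. \<Sum>\<sigma>\<in>Omega. u (s (r k)) \<sigma>) \<longlonglongrightarrow> (\<Sum>\<sigma>\<in>Omega. v \<sigma>)" by (intro tendsto_sum lim)
    then show "(\<Sum>\<sigma>\<in>Omega. v \<sigma>) = 1"
      using mass_function_u[OF s0] by (simp add: mass_function_def LIMSEQ_const_iff)
  qed
  have mean_v: "mean_spin v A = mean_spin (pmf p) A" if "A \<in> blocks" for A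
  proof -
    have "(\<lambda>k. mean_spin (u (s (r k))) A) \<longlonglongrightarrow> mean_spin v A"
      unfolding mean_spin_def divide_inverse by (intro tendsto_mult_right tendsto_sum lim)
    then show ?thesis by (simp add: mean_spin_constant[OF that s0] LIMSEQ_const_iff)
  qed
  have "dissipation v = 0"
  proof -
    have flux: "(\<lambda>k. flux J (u (s (r k))) a b x) \<longlonglongrightarrow> flux J v a b x" if "x \<in> Omega \<times> Omega" for a b x
      unfolding flux_def pair_mass_def using that by (intro tendsto_mult_left tendsto_mult lim) (auto simp: mem_Times_iff)
    have "(\<lambda>k. dissipation (u (s (r k)))) \<longlonglongrightarrow> dissipation v"
      unfolding dissipation_def
      by (intro tendsto_sum tendsto_mult_left tendsto_power tendsto_diff flux exchange_in_Omega)
    moreover have "(\<lambda>k. 1 / real (Suc (r k))) \<longlonglongrightarrow> 0"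
      using LIMSEQ_subseq_LIMSEQ[OF LIMSEQ_Suc[OF lim_1_over_n[where 'a = real]] r] by (simp add: o_def)
    ultimately have "dissipation v \<le> 0"
      using diss by (intro LIMSEQ_le) (auto intro: less_imp_le)
    then show ?thesis using dissipation_nonneg[of v] by simp
  qed
  then have "balanced v" by (simp add: dissipation_eq_0_iff)
  moreover have "0 < v \<sigma>" if "\<sigma> \<in> Omega" for \<sigma>
    using balanced_full_support[OF \<open>mass_function v\<close> \<open>balanced v\<close> _ that] mean mean_v by simp
  ultimately obtain h where h: "h \<in> Gamma_part blocks" "\<forall>\<sigma>\<in>Omega. v \<sigma> = pmf (ising J h) \<sigma>"
    using balanced_positive_is_ising[OF \<open>mass_function v\<close>] by blast
  have "mean_spin (pmf (ising J h)) A = mean_spin v A" for A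
    using h(2) by (simp add: mean_spin_def)
  then have "\<forall>A\<in>blocks. mean_spin (pmf (ising J h)) A = mean_spin (pmf p) A"
    using mean_v by simp
  moreover have "\<forall>\<sigma>\<in>Omega. (\<lambda>k. u (s (r k)) \<sigma>) \<longlonglongrightarrow> pmf (ising J h) \<sigma>"
    using lim h(2) by simp
  ultimately show ?thesis
    using h(1) s by (intro bexI[of _ h] conjI exI[of _ "\<lambda>k. s (r k)"]) blast+
qed

lemma field_ex:
  assumes mean: "\<And>A. A \<in> blocks \<Longrightarrow> \<bar>mean_spin (pmf p) A\<bar> \<noteq> 1"
  shows "\<exists>h\<in>Gamma_part blocks. \<forall>A\<in>blocks. mean_spin (pmf (ising J h)) A = mean_spin (pmf p) A"
proof -
  obtain T where "0 \<le> T" "\<And>t \<tau>. T \<le> t \<Longrightarrow> \<tau> \<in> Omega \<Longrightarrow> 0 < u t \<tau>"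
    using eventually_full_support[OF mean] by blast
  from ising_limit_point[OF mean this] show ?thesis by blast
qed

lemma entropy_nonincreasing:
  assumes "0 \<le> T" "\<And>t \<tau>. T \<le> t \<Longrightarrow> \<tau> \<in> Omega \<Longrightarrow> 0 < u t \<tau>" "h \<in> Gamma_part blocks" "T \<le> s" "s \<le> t"
  shows "rel_entropy (u t) (pmf (ising J h)) \<le> rel_entropy (u s) (pmf (ising J h))"
  using entropy_decay[OF assms(1-3) dissipation_nonneg assms(4,5)] by simp

text \<open>The entropy relative to \<open>\<mu>\<^bsub>J,h\<^esub>\<close> starts at its minimum \<open>0\<close> and cannot increase.\<close>
lemma ising_solution_constant:
  assumes h: "h \<in> Gamma_part blocks" and p: "p = ising J h" and t: "0 \<le> t"
  shows "P t = p"
proof (rule pmf_eq_on_Omega[OF P_Prob[OF t] p_Prob])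
  have "0 < u r \<tau>" if "0 \<le> r" "\<tau> \<in> Omega" for r \<tau>
    by (rule positivity_persists[OF order_refl that]) (use that p in \<open>simp add: u_0 pmf_ising_pos\<close>)
  then have "rel_entropy (u t) (pmf (ising J h)) \<le> rel_entropy (u 0) (pmf (ising J h))"
    using entropy_nonincreasing[OF order_refl _ h order_refl t] by blast
  also have "\<dots> = 0" by (simp add: u_0 p rel_entropy_def)
  finally have "(\<Sum>\<sigma>\<in>Omega. (sqrt (u t \<sigma>) - sqrt (pmf (ising J h) \<sigma>))\<^sup>2) \<le> 0"
    using rel_entropy_ge_hellinger[OF mass_function_u[OF t] mass_function_ising pmf_ising_pos, of J h] by linarith
  then have "(\<Sum>\<sigma>\<in>Omega. (sqrt (u t \<sigma>) - sqrt (pmf (ising J h) \<sigma>))\<^sup>2) = 0"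
    by (intro order.antisym sum_nonneg) auto
  then show "pmf (P t) \<sigma> = pmf p \<sigma>" if "\<sigma> \<in> Omega" for \<sigma>
    using that by (simp add: sum_nonneg_eq_0_iff finite_Omega p)
qed

text \<open>The limit point is \<open>\<mu>\<^bsub>J,h\<^esub>\<close> itself since the mean spins determine the field. Monotonicity then
  promotes the convergence of the entropy from a sequence of times to all times.\<close>
lemma convergence:
  assumes mean: "\<And>A. A \<in> blocks \<Longrightarrow> \<bar>mean_spin (pmf p) A\<bar> \<noteq> 1"
    and h: "h \<in> Gamma_part blocks"
    and mean_h: "\<And>A. A \<in> blocks \<Longrightarrow> mean_spin (pmf (ising J h)) A = mean_spin (pmf p) A"
  shows "((\<lambda>t. tv_dist (P t) (ising J h)) \<longlongrightarrow> 0) at_top"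
proof -
  let ?\<mu> = "pmf (ising J h)" and ?H = "\<lambda>t. rel_entropy (u t) (pmf (ising J h))"
  obtain T where T: "0 \<le> T" and pos: "\<And>t \<tau>. T \<le> t \<Longrightarrow> \<tau> \<in> Omega \<Longrightarrow> 0 < u t \<tau>"
    using eventually_full_support[OF mean] by blast
  obtain h' s where h': "h' \<in> Gamma_part blocks"
    and mean_h': "\<And>A. A \<in> blocks \<Longrightarrow> mean_spin (pmf (ising J h')) A = mean_spin (pmf p) A"
    and s: "\<And>k. T \<le> s k" and lim': "\<And>\<sigma>. \<sigma> \<in> Omega \<Longrightarrow> (\<lambda>k. u (s k) \<sigma>) \<longlonglongrightarrow> pmf (ising J h') \<sigma>"
    using ising_limit_point[OF mean T pos] by blast
  have "h' = h" using field_unique[OF h' h] mean_h mean_h' by simp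
  with lim' have lim: "(\<lambda>k. u (s k) \<sigma>) \<longlonglongrightarrow> ?\<mu> \<sigma>" if "\<sigma> \<in> Omega" for \<sigma> using that by simp
  have nz: "?\<mu> \<sigma> \<noteq> 0" if "\<sigma> \<in> Omega" for \<sigma> using pmf_ising_pos[OF that, of J h] by linarith
  have "(\<lambda>k. ?H (s k)) \<longlonglongrightarrow> (\<Sum>\<sigma>\<in>Omega. ?\<mu> \<sigma> * (ln (?\<mu> \<sigma>) - ln (?\<mu> \<sigma>)))"
    unfolding rel_entropy_def
    by (intro tendsto_sum tendsto_mult tendsto_diff tendsto_ln lim tendsto_const nz)
  then have H_lim: "(\<lambda>k. ?H (s k)) \<longlonglongrightarrow> 0" by simp
  have H: "(?H \<longlongrightarrow> 0) at_top"
  proof (rule tendstoI)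
    fix e :: real assume "0 < e"
    then obtain k where "?H (s k) < e"
      using order_tendstoD(2)[OF H_lim] by (auto simp: eventually_sequentially)
    then have "dist (?H t) 0 < e" if "s k \<le> t" for t
      using entropy_nonincreasing[OF T pos h s that] rel_entropy_ising_nonneg[of t h] s[of k] T that by simp
    then show "\<forall>\<^sub>F t in at_top. dist (?H t) 0 < e"
      using eventually_at_top_linorder by blast
  qed
  have pointwise: "((\<lambda>t. u t \<sigma>) \<longlongrightarrow> ?\<mu> \<sigma>) at_top" if \<sigma>: "\<sigma> \<in> Omega" for \<sigma>
  proof -
    have "(sqrt (u t \<sigma>) - sqrt (?\<mu> \<sigma>))\<^sup>2 \<le> ?H t" if "0 \<le> t" for t
    proof -
      have "(sqrt (u t \<sigma>) - sqrt (?\<mu> \<sigma>))\<^sup>2 \<le> (\<Sum>\<sigma>\<in>Omega. (sqrt (u t \<sigma>) - sqrt (?\<mu> \<sigma>))\<^sup>2)"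
        using \<sigma> finite_Omega by (intro member_le_sum) auto
      also have "\<dots> \<le> ?H t"
        by (rule rel_entropy_ge_hellinger[OF mass_function_u[OF that] mass_function_ising pmf_ising_pos])
      finally show ?thesis .
    qed
    then have "\<forall>\<^sub>F t in at_top. (sqrt (u t \<sigma>) - sqrt (?\<mu> \<sigma>))\<^sup>2 \<le> ?H t"
      by (intro eventually_mono[OF eventually_ge_at_top[of "0::real"]])
    then have "((\<lambda>t. (sqrt (u t \<sigma>) - sqrt (?\<mu> \<sigma>))\<^sup>2) \<longlongrightarrow> 0) at_top"
      by (intro tendsto_sandwich[OF _ _ tendsto_const H]) simp_all
    then have "((\<lambda>t. sqrt ((sqrt (u t \<sigma>) - sqrt (?\<mu> \<sigma>))\<^sup>2)) \<longlongrightarrow> sqrt 0) at_top"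
      by (rule tendsto_real_sqrt)
    then have "((\<lambda>t. sqrt (u t \<sigma>) - sqrt (?\<mu> \<sigma>)) \<longlongrightarrow> 0) at_top"
      by (simp add: tendsto_rabs_zero_iff)
    then have "((\<lambda>t. sqrt (u t \<sigma>)) \<longlongrightarrow> sqrt (?\<mu> \<sigma>)) at_top"
      by (simp add: LIM_zero_iff)
    then have "((\<lambda>t. (sqrt (u t \<sigma>))\<^sup>2) \<longlongrightarrow> (sqrt (?\<mu> \<sigma>))\<^sup>2) at_top"
      by (rule tendsto_power)
    then show ?thesis by simp
  qed
  have "((\<lambda>t. \<Sum>\<sigma>\<in>Omega. \<bar>u t \<sigma> - ?\<mu> \<sigma>\<bar>) \<longlongrightarrow> (\<Sum>\<sigma>\<in>Omega. \<bar>?\<mu> \<sigma> - ?\<mu> \<sigma>\<bar>)) at_top"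
    by (intro tendsto_sum tendsto_rabs tendsto_diff pointwise tendsto_const)
  then have "((\<lambda>t. \<Sum>\<sigma>\<in>Omega. \<bar>u t \<sigma> - ?\<mu> \<sigma>\<bar>) \<longlongrightarrow> 0) at_top" by simp
  moreover have "\<forall>\<^sub>F t in at_top. 0 \<le> tv_dist (P t) (ising J h)"
    "\<forall>\<^sub>F t in at_top. tv_dist (P t) (ising J h) \<le> (\<Sum>\<sigma>\<in>Omega. \<bar>u t \<sigma> - ?\<mu> \<sigma>\<bar>)"
    by (rule eventually_mono[OF eventually_ge_at_top[of "0::real"]],
        rule conjunct1[OF tv_dist_le_l1] conjunct2[OF tv_dist_le_l1], erule P_Prob, rule ising_in_Prob)+
  ultimately show ?thesis
    by (rule tendsto_sandwich[OF _ _ tendsto_const, rotated 2])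
qed

end

theorem theorem1p5:
  fixes J K :: "real ^ 'n ^ 'n::finite" and \<A> :: "'n set set"
  assumes J_symmetric: "transpose J = J"
    and K_symmetric: "transpose K = K"
    and K_stochastic: "stochastic_matrix K"
    and \<A>_def: "\<A> = irreducible_components K"
  shows
    "(\<forall>p\<in>Prob_part \<A>.
        (stationary J K p \<longleftrightarrow> (\<forall>P. solves_nonlinear J K p P \<longrightarrow> (\<forall>t\<ge>0. P t = p))) \<and>
        (stationary J K p \<longleftrightarrow> (\<exists>h\<in>Gamma_part \<A>. p = ising J h)))
     \<and> (\<forall>p\<in>Prob. \<forall>P. solves_nonlinear J K p P \<longrightarrow>
          (\<forall>A\<in>\<A>. \<forall>t\<ge>0. mag (P t) A = mag p A))
     \<and> (\<forall>p\<in>Prob_part \<A>.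
          (\<exists>!h. h \<in> Gamma_part \<A> \<and> mags \<A> p = mags \<A> (ising J h)) \<and>
          (\<forall>P h. solves_nonlinear J K p P \<and> h \<in> Gamma_part \<A> \<and> mags \<A> p = mags \<A> (ising J h) \<longrightarrow>
             ((\<lambda>t. tv_dist (P t) (ising J h)) \<longlongrightarrow> 0) at_top))"
proof -
  interpret exchange_dynamics J K
  proof
    fix l k
    show "K $ l $ k = K $ k $ l" using K_symmetric by (metis transpose_def vec_lambda_beta)
    show "0 \<le> K $ l $ k" "(\<Sum>k\<in>UNIV. K $ l $ k) = 1" using K_stochastic by (simp_all add: stochastic_matrix_def)
  qed
  have solution: "exchange_solution J K p P" if "p \<in> Prob" "solves_nonlinear J K p P" for p P
    using that by unfold_locales
  have mean: "\<bar>mean_spin (pmf p) A\<bar> \<noteq> 1" if "p \<in> Prob_part \<A>" "A \<in> blocks" for p A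
    using that by (auto simp: Prob_part_def \<A>_def mag_eq_mean_spin)
  have Prob: "p \<in> Prob" if "p \<in> Prob_part \<A>" for p using that by (simp add: Prob_part_def)
  have mags: "mags \<A> p = mags \<A> (ising J h) \<longleftrightarrow> (\<forall>A\<in>blocks. mean_spin (pmf (ising J h)) A = mean_spin (pmf p) A)"
    if "p \<in> Prob" for p h
    using that ising_in_Prob[of J h] unfolding mags_def \<A>_def
    by (auto simp: mag_eq_mean_spin restrict_def fun_eq_iff)
  show ?thesis
  proof (intro conjI ballI allI impI)
    fix p assume p: "p \<in> Prob_part \<A>"
    show "stationary J K p \<longleftrightarrow> (\<exists>h\<in>Gamma_part \<A>. p = ising J h)"
      unfolding \<A>_def by (rule stationary_iff_ising[OF Prob[OF p] mean[OF p]])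
    then show "stationary J K p \<longleftrightarrow> (\<forall>P. solves_nonlinear J K p P \<longrightarrow> (\<forall>t\<ge>0. P t = p))"
    proof (intro iffI allI impI)
      fix P t assume "stationary J K p" "solves_nonlinear J K p P" "0 \<le> (t::real)"
      then show "P t = p"
        using \<open>stationary J K p \<longleftrightarrow> (\<exists>h\<in>Gamma_part \<A>. p = ising J h)\<close> unfolding \<A>_def
        using exchange_solution.ising_solution_constant[OF solution[OF Prob[OF p]]] by blast
    next
      assume const: "\<forall>P. solves_nonlinear J K p P \<longrightarrow> (\<forall>t\<ge>0. P t = p)"
      obtain P where P: "solves_nonlinear J K p P" using solution_ex[OF Prob[OF p]] by blast
      then have P_eq: "P t = p" if "0 \<le> t" for t using const that by blast
      interpret exchange_solution J K p P by (rule solution[OF Prob[OF p] P])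
      have "collide J K (pmf p) (pmf p) \<tau> - pmf p \<tau> = 0" if \<tau>: "\<tau> \<in> Omega" for \<tau>
      \<comment> \<open>Any positive time will do; at \<open>1\<close> the derivative is two-sided.\<close>
      proof (rule DERIV_local_const[of _ _ 1 1])
        show "((\<lambda>s. pmf (P s) \<tau>) has_real_derivative collide J K (pmf p) (pmf p) \<tau> - pmf p \<tau>) (at 1)"
          using u_deriv[of 1 \<tau>, OF _ \<tau>] P_eq[of 1] at_within_interior[of 1 "{0::real..}"]
          by (simp add: interior_real_atLeast)
      qed (auto simp: P_eq)
      then show "stationary J K p" by (simp add: stationary_def collision_eq_collide)
    qed
  next
    fix p P A and t :: real
    assume *: "p \<in> Prob" "solves_nonlinear J K p P" "A \<in> \<A>" "0 \<le> t"
    interpret exchange_solution J K p P by (rule solution[OF *(1,2)])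
    show "mag (P t) A = mag p A"
      using mean_spin_constant[of A t] P_Prob[of t] * by (simp add: mag_eq_mean_spin \<A>_def)
  next
    fix p assume p: "p \<in> Prob_part \<A>"
    obtain P where P: "solves_nonlinear J K p P" using solution_ex[OF Prob[OF p]] by blast
    interpret exchange_solution J K p P by (rule solution[OF Prob[OF p] P])
    obtain h where "h \<in> Gamma_part blocks" "\<forall>A\<in>blocks. mean_spin (pmf (ising J h)) A = mean_spin (pmf p) A"
      using field_ex[OF mean[OF p]] by blast
    then show "\<exists>!h. h \<in> Gamma_part \<A> \<and> mags \<A> p = mags \<A> (ising J h)"
      unfolding mags[OF Prob[OF p]] unfolding \<A>_def by (intro ex1I[of _ h]) (auto intro: field_unique)
  next
    fix p P h
    assume p: "p \<in> Prob_part \<A>"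
      and *: "solves_nonlinear J K p P \<and> h \<in> Gamma_part \<A> \<and> mags \<A> p = mags \<A> (ising J h)"
    then interpret exchange_solution J K p P by (intro solution Prob) auto
    show "((\<lambda>t. tv_dist (P t) (ising J h)) \<longlongrightarrow> 0) at_top"
      using * unfolding mags[OF Prob[OF p]] unfolding \<A>_def by (intro convergence mean[OF p]) auto
  qed
qed

end
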